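(* Given any positive integers $a$ and $b$, $F$ can be regarded as a non-split extension of $\mathbb{Z}_a\times\mathbb{Z}_b$ by $F$. In particular, there are maps (homomorphisms) $\iota:F\to F$ and $\tau:F\to\mathbb{Z}_a\times\mathbb{Z}_b$ so that the following sequence is exact: $$1\to F\xrightarrow{\ \iota\ }F\xrightarrow{\ \tau\ }\mathbb{Z}_a\times\mathbb{Z}_b\to 1.$$
   Context: $F$ (R. Thompson's group $F$) is the group, under composition, of all piecewise-linear, orientation-preserving homeomorphisms of the unit interval $[0,1]$ which admit finitely many breaks in slope, where these breaks occur only over the dyadic rationals $\mathbb{Z}[1/2]$, and where all slopes of affine segments of the graphs are integral powers of $2$. $\mathbb{Z}_n$ denotes the cyclic group of order $n$. An extension of $\mathbb{Z}_a\times\mathbb{Z}_b$ by $F$ here has kernel $F$ and quotient $\mathbb{Z}_a\times\mathbb{Z}_b$, as in the displayed sequence; non-split has its usual meaning, that there is no homomorphism $\sigma:\mathbb{Z}_a\times\mathbb{Z}_b\to F$ (into the middle group) such that applying $\sigma$ and then $\tau$ gives the identity of $\mathbb{Z}_a\times\mathbb{Z}_b$.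
   Formalization: Non-splitness is asserted for all positive a, b except a = b = 1, where the quotient is trivial and the trivial homomorphism is a section, so the extension splits; the exact sequence is still asserted for all positive a and b. *)

theory Defs
  imports "HOL-Analysis.Analysis" "HOL-Algebra.Algebra"
begin

text \<open>
  Elements of $F$ are maps on \<^term>\<open>{0..1::real}\<close>, encoded as extensional functions
  (undefined outside the interval), so that \<^const>\<open>BijGroup\<close> is the ambient group.
\<close>

(* The finite set B contains all breaks.  The library set dyadics consists of the nonnegative
   dyadic rationals only; this loses nothing, since breaks lie in [0,1].  On each
   interval without a break in its interior, f is affine with slope an integral power of 2. *)
definition dyadic_piecewise_linear :: "(real \<Rightarrow> real) \<Rightarrow> bool" where
  "dyadic_piecewise_linear f \<longleftrightarrow>
    (\<exists>B. finite B \<and> B \<subseteq> dyadics \<and>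
      (\<forall>u v. 0 \<le> u \<and> u < v \<and> v \<le> 1 \<and> {u<..<v} \<inter> B = {} \<longrightarrow>
        (\<exists>(k::int) c. \<forall>x\<in>{u..v}. f x = 2 powi k * x + c)))"

definition thompson_F :: "(real \<Rightarrow> real) monoid" where
  "thompson_F = (BijGroup {0..1})
    \<lparr>carrier := {f \<in> Bij {0..1}. (\<exists>g. homeomorphism {0..1} {0..1} f g) \<and>
        strict_mono_on {0..1} f \<and> dyadic_piecewise_linear f}\<rparr>"

(* Exactness of 1 -> K -> G -> Q -> 1.  The library's short_exact_sequence requires
   all groups to have the same element type, hence this heterogeneous version. *)
definition group_extension ::
    "'k monoid \<Rightarrow> 'g monoid \<Rightarrow> 'q monoid \<Rightarrow> ('k \<Rightarrow> 'g) \<Rightarrow> ('g \<Rightarrow> 'q) \<Rightarrow> bool" where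
  "group_extension K G Q \<iota> \<tau> \<longleftrightarrow>
    group_hom K G \<iota> \<and> group_hom G Q \<tau> \<and>
    \<iota> \<in> mon K G \<and> \<iota> ` carrier K = kernel G Q \<tau> \<and> \<tau> \<in> epi G Q"

definition split_extension :: "'g monoid \<Rightarrow> 'q monoid \<Rightarrow> ('g \<Rightarrow> 'q) \<Rightarrow> bool" where
  "split_extension G Q \<tau> \<longleftrightarrow> (\<exists>\<sigma> \<in> hom Q G. \<forall>q \<in> carrier Q. \<tau> (\<sigma> q) = q)"

end

theory Submission
  imports Defs
begin

text \<open>
  An element $f$ of $F$ multiplies the distance to the end $0$ by some $2^i$ near $0$, and the
  distance to the end $1$ by some $2^j$ near $1$.  The pair $(i,j)$ depends homomorphically on $f$ and
  takes all values, so reducing it modulo $a$ and $b$ gives an epimorphism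
  $\tau : F \to \mathbb{Z}_a \times \mathbb{Z}_b$.  Its kernel $K$ consists of the elements with
  $a \mid i$ and $b \mid j$.  The point is that $K$ is isomorphic to $F$ by a single conjugation.

  Suppose that $\theta$ is an increasing homeomorphism of $[0,1]$ that is locally dyadic piecewise
  linear in the open interval, with breaks that may accumulate at the ends, and that satisfies
  $\theta(2x) = 2^a \theta(x)$ for all small $x$ and the analogous relation with $b$ near $1$.  Then
  $\theta \circ g \circ \theta^{-1}$ has the slope exponents $(ai, bj)$ if $g$ has $(i,j)$.  In
  particular the conjugate is linear near the ends, so that its breaks do not accumulate any more: it
  is an element of $F$, and in fact of $K$ (\<open>germ_conj\<close>).  The inverse conjugation carries $K$ back into
  $F$ for the same reason (\<open>germ_conj_inverse\<close>).  Hence $\iota(g) = \theta \circ g \circ \theta^{-1}$ is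
  an isomorphism from $F$ onto $K$ (\<open>conj_extension\<close>).  Such a $\theta$ is obtained from a dyadic
  piecewise linear map of the fundamental domain $[1,2]$ of $x \mapsto 2x$ onto the fundamental domain
  $[1,2^a]$ of $x \mapsto 2^a x$, extended equivariantly (\<open>stretch\<close>, \<open>two_sided_stretch\<close>).

  To make these arguments local, $F$ is characterised by one-sided germs (\<open>carrier_thompson_F\<close>): an
  increasing bijection of the interval belongs to $F$ exactly if at every interior point it has affine
  germs on both sides with slopes powers of two, with a break only at dyadic points and respecting
  dyadicity, and if it has such a germ at both ends.  Compactness turns this into finitely many breaks.

  The extension does not split unless the quotient is trivial, because $F$ is torsion-free
  (\<open>thompson_F_torsion_free\<close>).
\<close>

section \<open>One-sided affine germs\<close>

text \<open>
  Unlike \<^const>\<open>dyadics\<close> this set also contains negative numbers, so that it is closed under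
  differences and translations preserve membership.
\<close>

definition dyadic_reals :: "real set" where
  "dyadic_reals = {x. \<exists>n::nat. x * 2 ^ n \<in> \<int>}"

lemma dyadic_reals_0 [simp]: "0 \<in> dyadic_reals"
  and dyadic_reals_1 [simp]: "1 \<in> dyadic_reals"
  unfolding dyadic_reals_def by (auto intro: exI[of _ 0])

lemma dyadic_reals_add:
  assumes "x \<in> dyadic_reals" "y \<in> dyadic_reals"
  shows "x + y \<in> dyadic_reals"
proof -
  from assms obtain m n where m: "x * 2 ^ m \<in> \<int>" and n: "y * 2 ^ n \<in> \<int>"
    by (auto simp: dyadic_reals_def)
  have "(x + y) * 2 ^ (m + n) = (x * 2 ^ m) * 2 ^ n + (y * 2 ^ n) * 2 ^ m"
    by (simp add: power_add algebra_simps)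
  also have "\<dots> \<in> \<int>"
    by (intro Ints_add Ints_mult Ints_power m n) auto
  finally show ?thesis
    by (auto simp: dyadic_reals_def)
qed

lemma dyadic_reals_uminus_iff [simp]: "- x \<in> dyadic_reals \<longleftrightarrow> x \<in> dyadic_reals"
  by (simp add: dyadic_reals_def)

lemma dyadic_reals_diff:
  "x \<in> dyadic_reals \<Longrightarrow> y \<in> dyadic_reals \<Longrightarrow> x - y \<in> dyadic_reals"
  using dyadic_reals_add[of x "- y"] by simp

lemma dyadic_reals_powi_mult:
  assumes "x \<in> dyadic_reals"
  shows "2 powi k * x \<in> dyadic_reals"
proof -
  from assms obtain n where n: "x * 2 ^ n \<in> \<int>"
    by (auto simp: dyadic_reals_def)
  have "(2 powi k * x) * 2 ^ (n + nat (- k)) \<in> \<int>"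
  proof (cases "k \<ge> 0")
    case True
    then have "(2 powi k * x) * 2 ^ (n + nat (- k)) = 2 ^ nat k * (x * 2 ^ n)"
      by (simp add: power_int_nonneg_exp)
    also have "\<dots> \<in> \<int>"
      by (intro Ints_mult n) auto
    finally show ?thesis .
  next
    case False
    then have "(2 powi k :: real) * 2 ^ nat (- k) = 1"
      by (simp add: power_int_def field_simps)
    then have "(2 powi k * x) * 2 ^ (n + nat (- k)) = x * 2 ^ n"
      by (simp add: power_add algebra_simps)
    with n show ?thesis by (simp only:)
  qed
  then show ?thesis
    unfolding dyadic_reals_def by blast
qed

lemma dyadic_reals_powi_mult_iff [simp]:
  "2 powi k * x \<in> dyadic_reals \<longleftrightarrow> x \<in> dyadic_reals"
proof
  assume "2 powi k * x \<in> dyadic_reals"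
  from dyadic_reals_powi_mult[OF this, of "- k"] show "x \<in> dyadic_reals"
    by (simp add: power_int_minus mult.assoc[symmetric])
qed (rule dyadic_reals_powi_mult)

lemma dyadic_reals_powi [simp]: "2 powi k \<in> dyadic_reals"
  using dyadic_reals_powi_mult_iff[of k 1] by simp

lemma dyadic_reals_iff_dyadics:
  assumes "x \<ge> 0"
  shows "x \<in> dyadic_reals \<longleftrightarrow> x \<in> dyadics"
proof
  assume "x \<in> dyadic_reals"
  then obtain n where "x * 2 ^ n \<in> \<int>"
    by (auto simp: dyadic_reals_def)
  moreover have "x * 2 ^ n \<ge> 0"
    using assms by simp
  ultimately have "x * 2 ^ n \<in> \<nat>"
    by (simp add: Nats_altdef2)
  then obtain m where "x * 2 ^ n = of_nat m"
    by (auto simp: Nats_def)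
  then have "x = of_nat m / 2 ^ n"
    by (simp add: field_simps)
  then show "x \<in> dyadics"
    unfolding dyadics_def by blast
next
  assume "x \<in> dyadics"
  then obtain m n where "x = of_nat m / 2 ^ n"
    by (auto simp: dyadics_def)
  then have "x * 2 ^ n \<in> \<int>" by simp
  then show "x \<in> dyadic_reals"
    by (auto simp: dyadic_reals_def)
qed

text \<open>
  The number \<open>s\<close> is the direction: \<open>s = 1\<close> describes $f$ to the right of $x$, \<open>s = -1\<close> to the
  left.  Treating the direction as a real factor lets one proof serve both sides of a point and
  both ends of the interval.
\<close>

definition germ :: "real \<Rightarrow> (real \<Rightarrow> real) \<Rightarrow> real \<Rightarrow> int \<Rightarrow> bool" where
  "germ s f x k \<longleftrightarrow> (\<forall>\<^sub>F t in at_right 0. f (x + s * t) = f x + s * (2 powi k * t))"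

lemma eventually_at_right_0_scale:
  fixes c :: real
  assumes "c > 0" "eventually P (at_right 0)"
  shows "\<forall>\<^sub>F t in at_right 0. P (c * t)"
proof -
  have "filterlim (\<lambda>t. c * t) (at_right 0) (at_right 0)"
    by (rule filterlim_times_pos[OF filterlim_ident]) (use assms in auto)
  from eventually_compose_filterlim[OF assms(2) this] show ?thesis .
qed

lemma germ_unique:
  assumes "germ s f x k" "germ s f x l" "s \<noteq> 0"
  shows "k = l"
proof -
  have "\<forall>\<^sub>F t in at_right 0. 0 < t \<and> s * (2 powi k * t) = s * (2 powi l * t)"
    using assms(1,2)[unfolded germ_def] eventually_at_right_less[of 0]
    by eventually_elim auto
  then obtain t where "0 < t" "s * (2 powi k * t) = s * (2 powi l * t)"
    using eventually_happens'[OF trivial_limit_at_right_real] by blast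
  with assms(3) have "(2::real) powi k = 2 powi l" by simp
  then show ?thesis
    using power_int_strict_increasing[of k l "2::real"] power_int_strict_increasing[of l k "2::real"]
    by (cases k l rule: linorder_cases) auto
qed

lemma germ_compose:
  assumes "germ s f x k" "germ s g (f x) l"
  shows "germ s (\<lambda>x. g (f x)) x (k + l)"
proof -
  have "\<forall>\<^sub>F t in at_right 0. g (f x + s * (2 powi k * t)) = g (f x) + s * (2 powi l * (2 powi k * t))"
    using assms(2) unfolding germ_def by (rule eventually_at_right_0_scale[rotated]) simp
  with assms(1)[unfolded germ_def] show ?thesis
    unfolding germ_def
    by eventually_elim (simp add: power_int_add)
qed

text \<open>
  The equation $g(f(x + st)) = x + st$ becomes an equation for $g$ after the substitution
  $t \mapsto 2^{-k} t$, which keeps small positive parameters small and positive.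
\<close>

lemma germ_inverse:
  assumes "germ s f x k" "g (f x) = x" "\<forall>\<^sub>F t in at_right 0. g (f (x + s * t)) = x + s * t"
  shows "germ s g (f x) (- k)"
proof -
  have *: "(2 powi k :: real) * (2 powi (- k) * t) = t" for t
    by (simp add: power_int_minus)
  have "\<forall>\<^sub>F t in at_right 0. g (f x + s * (2 powi k * t)) = x + s * t"
    using assms(1)[unfolded germ_def] assms(3) by eventually_elim simp
  then have "\<forall>\<^sub>F t in at_right 0. g (f x + s * (2 powi k * (2 powi (- k) * t))) = x + s * (2 powi (- k) * t)"
    by (rule eventually_at_right_0_scale[rotated]) simp
  then show ?thesis
    unfolding germ_def * assms(2) .
qed

lemma germ_cong:
  assumes "\<forall>\<^sub>F t in at_right 0. f (x + s * t) = g (x + s * t)" "f x = g x"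
  shows "germ s f x k \<longleftrightarrow> germ s g x k"
  unfolding germ_def
  by (rule eventually_cong[OF assms(1)]) (simp add: assms(2))

text \<open>
  A chain rule needs that a break of the outer map is hit only at a dyadic point, hence the clause
  that the map neither creates nor destroys dyadicity at $x$.
\<close>

definition dyadic_PL_at :: "(real \<Rightarrow> real) \<Rightarrow> real \<Rightarrow> bool" where
  "dyadic_PL_at f x \<longleftrightarrow> (x \<in> dyadic_reals \<longleftrightarrow> f x \<in> dyadic_reals) \<and>
     (\<exists>k l. germ 1 f x k \<and> germ (-1) f x l \<and> (x \<notin> dyadic_reals \<longrightarrow> k = l))"

lemma eventually_interval_at_right_0:
  fixes x s :: real
  assumes "a < x" "x < b"
  shows "\<forall>\<^sub>F t in at_right 0. x + s * t \<in> {a<..<b}"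
proof (rule topological_tendstoD)
  show "((\<lambda>t. x + s * t) \<longlongrightarrow> x) (at_right 0)"
    by (auto intro!: tendsto_eq_intros)
qed (use assms in auto)

lemma dyadic_PL_at_cong:
  assumes "\<And>y. a < y \<Longrightarrow> y < b \<Longrightarrow> f y = g y" "a < x" "x < b"
  shows "dyadic_PL_at f x \<longleftrightarrow> dyadic_PL_at g x"
proof -
  have "germ s f x k \<longleftrightarrow> germ s g x k" for s k
    by (rule germ_cong[OF eventually_mono[OF eventually_interval_at_right_0[OF assms(2,3)]]])
      (use assms in auto)
  then show ?thesis
    using assms unfolding dyadic_PL_at_def by simp
qed

lemma dyadic_PL_at_compose:
  assumes "dyadic_PL_at f x" "dyadic_PL_at g (f x)"
  shows "dyadic_PL_at (\<lambda>x. g (f x)) x"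
proof -
  obtain k l k' l' where
    "germ 1 f x k" "germ (-1) f x l" "x \<notin> dyadic_reals \<longrightarrow> k = l"
    "germ 1 g (f x) k'" "germ (-1) g (f x) l'" "f x \<notin> dyadic_reals \<longrightarrow> k' = l'"
    using assms unfolding dyadic_PL_at_def by blast
  then have "germ 1 (\<lambda>x. g (f x)) x (k + k')" "germ (-1) (\<lambda>x. g (f x)) x (l + l')"
    by (auto intro: germ_compose)
  moreover have "x \<notin> dyadic_reals \<longrightarrow> k + k' = l + l'"
    using \<open>x \<notin> dyadic_reals \<longrightarrow> k = l\<close> \<open>f x \<notin> dyadic_reals \<longrightarrow> k' = l'\<close> assms(1)
    by (simp add: dyadic_PL_at_def)
  moreover have "x \<in> dyadic_reals \<longleftrightarrow> g (f x) \<in> dyadic_reals"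
    using assms by (simp add: dyadic_PL_at_def)
  ultimately show ?thesis
    unfolding dyadic_PL_at_def by blast
qed

lemma dyadic_PL_at_inverse:
  assumes "dyadic_PL_at f x" "\<And>y. a < y \<Longrightarrow> y < b \<Longrightarrow> g (f y) = y" "a < x" "x < b"
  shows "dyadic_PL_at g (f x)"
proof -
  obtain k l where kl: "germ 1 f x k" "germ (-1) f x l" "x \<notin> dyadic_reals \<longrightarrow> k = l"
    using assms unfolding dyadic_PL_at_def by blast
  have gf: "g (f x) = x" using assms by simp
  have ev: "\<forall>\<^sub>F t in at_right 0. g (f (x + s * t)) = x + s * t" for s
    by (rule eventually_mono[OF eventually_interval_at_right_0[OF assms(3,4)]])
      (use assms in auto)
  have "germ 1 g (f x) (- k)" "germ (-1) g (f x) (- l)"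
    using germ_inverse[OF kl(1) gf ev] germ_inverse[OF kl(2) gf ev] .
  then show ?thesis
    using kl(3) assms(1) gf unfolding dyadic_PL_at_def by (metis (no_types))
qed

lemma germ_reflect: "germ s (\<lambda>x. 1 - f (1 - x)) x k \<longleftrightarrow> germ (- s) f (1 - x) k"
proof -
  have "1 - (x + s * t) = 1 - x + - s * t" for t by simp
  then show ?thesis unfolding germ_def
    by (intro eventually_cong[OF always_eventually]) (auto simp: algebra_simps)
qed

lemma dyadic_reals_reflect [simp]: "1 - x \<in> dyadic_reals \<longleftrightarrow> x \<in> dyadic_reals"
  using dyadic_reals_diff[of 1 x] dyadic_reals_diff[of 1 "1 - x"] by auto

lemma dyadic_PL_at_reflect:
  "dyadic_PL_at f (1 - x) \<Longrightarrow> dyadic_PL_at (\<lambda>x. 1 - f (1 - x)) x"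
  unfolding dyadic_PL_at_def germ_reflect by force

lemma germ_scale:
  assumes "germ s f (2 powi k * x) m"
  shows "germ s (\<lambda>x. 2 powi l * f (2 powi k * x)) x (l + m + k)"
proof -
  have "\<forall>\<^sub>F t in at_right 0. f (2 powi k * x + s * (2 powi k * t)) = f (2 powi k * x) + s * (2 powi m * (2 powi k * t))"
    using assms unfolding germ_def by (rule eventually_at_right_0_scale[rotated]) simp
  then show ?thesis
    unfolding germ_def by eventually_elim (simp add: power_int_add algebra_simps)
qed

lemma dyadic_PL_at_scale:
  assumes "dyadic_PL_at f (2 powi k * x)"
  shows "dyadic_PL_at (\<lambda>x. 2 powi l * f (2 powi k * x)) x"
  using assms germ_scale unfolding dyadic_PL_at_def dyadic_reals_powi_mult_iff by metis

section \<open>The group of locally dyadic piecewise linear maps\<close>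

text \<open>
  These maps may have infinitely many breaks, provided that the breaks accumulate only at the ends
  of the interval.  Conjugators that carry $F$ onto a proper subgroup live here, not in $F$.
\<close>

definition local_PL :: "(real \<Rightarrow> real) set" where
  "local_PL = {f \<in> Bij {0..1}. strict_mono_on {0..1} f \<and> (\<forall>x\<in>{0<..<1}. dyadic_PL_at f x)}"

text \<open>
  Each end of the interval is paired with the direction that points into the interval.
\<close>

definition interval_ends :: "(real \<times> real) set" where
  "interval_ends = {(0, 1), (1, - 1)}"

abbreviation "BG \<equiv> BijGroup {0..1::real}"

interpretation BG: group BG
  by (rule group_BijGroup)

lemma carrier_BG: "carrier BG = Bij {0..1}"
  by (simp add: BijGroup_def)

lemma mult_BG: "f \<in> Bij {0..1} \<Longrightarrow> g \<in> Bij {0..1} \<Longrightarrow> f \<otimes>\<^bsub>BG\<^esub> g = compose {0..1} f g"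
  by (simp add: BijGroup_def)

lemma mult_BG_apply:
  "f \<in> Bij {0..1} \<Longrightarrow> g \<in> Bij {0..1} \<Longrightarrow> x \<in> {0..1} \<Longrightarrow> (f \<otimes>\<^bsub>BG\<^esub> g) x = f (g x)"
  by (simp add: mult_BG compose_def)

lemma one_BG_apply: "x \<in> {0..1} \<Longrightarrow> \<one>\<^bsub>BG\<^esub> x = x"
  by (simp add: BijGroup_def)

lemma Bij_mem: "f \<in> Bij S \<Longrightarrow> x \<in> S \<Longrightarrow> f x \<in> S"
  using Bij_imp_funcset by blast

lemma inv_BG_apply:
  assumes "f \<in> Bij {0..1}" "x \<in> {0..1}"
  shows "(inv\<^bsub>BG\<^esub> f) (f x) = x" "f ((inv\<^bsub>BG\<^esub> f) x) = x"
proof -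
  have b: "bij_betw f {0..1} {0..1}" using assms(1) by (simp add: Bij_def)
  show "(inv\<^bsub>BG\<^esub> f) (f x) = x"
    using bij_betw_inv_into_left[OF b assms(2)] Bij_mem[OF assms]
    by (simp only: inv_BijGroup[OF assms(1)] restrict_apply')
  show "f ((inv\<^bsub>BG\<^esub> f) x) = x"
    using bij_betw_inv_into_right[OF b assms(2)]
    by (simp only: inv_BijGroup[OF assms(1)] restrict_apply'[OF assms(2)])
qed

lemma inv_BG_Bij: "f \<in> Bij {0..1} \<Longrightarrow> inv\<^bsub>BG\<^esub> f \<in> Bij {0..1}"
  using BG.inv_closed by (simp add: carrier_BG)

lemma increasing_bij_ends:
  assumes "f \<in> Bij {0..1::real}" "strict_mono_on {0..1} f"
  shows "f 0 = 0" "f 1 = (1::real)"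
proof -
  have im: "f ` {0..1} = {0..1}"
    using assms(1) by (simp add: Bij_def bij_betw_def)
  then obtain y z where yz: "y \<in> {0..1}" "f y = 0" "z \<in> {0..1}" "f z = 1"
    by (metis (no_types, lifting) atLeastAtMost_iff imageE le_numeral_extra(3) zero_le_one le_numeral_extra(4))
  have "f 0 \<le> f y" "f z \<le> f 1"
    using yz strict_mono_on_leD[OF assms(2), of 0 y] strict_mono_on_leD[OF assms(2), of z 1] by auto
  moreover have "f 0 \<in> {0..1}" "f 1 \<in> {0..1}"
    using im by auto
  ultimately show "f 0 = 0" "f 1 = 1"
    using yz by auto
qed

lemma local_PL_Bij: "f \<in> local_PL \<Longrightarrow> f \<in> Bij {0..1}"
  and local_PL_mono: "f \<in> local_PL \<Longrightarrow> strict_mono_on {0..1} f"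
  and local_PL_at: "f \<in> local_PL \<Longrightarrow> 0 < x \<Longrightarrow> x < 1 \<Longrightarrow> dyadic_PL_at f x"
  by (auto simp: local_PL_def)

lemma local_PL_ends: "f \<in> local_PL \<Longrightarrow> (p, s) \<in> interval_ends \<Longrightarrow> f p = p"
  using increasing_bij_ends[of f] by (auto simp: local_PL_def interval_ends_def)

lemma local_PL_interior:
  assumes "f \<in> local_PL" "0 < x" "x < 1"
  shows "0 < f x" "f x < 1"
  using increasing_bij_ends[of f] strict_mono_onD[of "{0..1}" f 0 x] strict_mono_onD[of "{0..1}" f x 1] assms
  by (auto simp: local_PL_def)

lemma one_local_PL: "\<one>\<^bsub>BG\<^esub> \<in> local_PL"
proof -
  have "germ s (\<lambda>x. x) x 0" for s x
    by (simp add: germ_def)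
  then have id: "dyadic_PL_at (\<lambda>x. x) x" for x
    by (auto simp: dyadic_PL_at_def)
  have "dyadic_PL_at \<one>\<^bsub>BG\<^esub> x" if "0 < x" "x < 1" for x
    by (subst dyadic_PL_at_cong[of 0 1 _ "\<lambda>x. x"]) (use that id one_BG_apply in auto)
  then show ?thesis
    using BG.one_closed by (auto simp: local_PL_def carrier_BG one_BG_apply strict_mono_on_def)
qed

lemma mult_local_PL:
  assumes "f \<in> local_PL" "g \<in> local_PL"
  shows "f \<otimes>\<^bsub>BG\<^esub> g \<in> local_PL"
proof -
  note B = local_PL_Bij[OF assms(1)] local_PL_Bij[OF assms(2)]
  have "dyadic_PL_at (f \<otimes>\<^bsub>BG\<^esub> g) x" if "0 < x" "x < 1" for x
  proof (subst dyadic_PL_at_cong[of 0 1 _ "\<lambda>x. f (g x)"])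
    show "dyadic_PL_at (\<lambda>x. f (g x)) x"
      by (rule dyadic_PL_at_compose[OF local_PL_at[OF assms(2) that]
            local_PL_at[OF assms(1) local_PL_interior[OF assms(2) that]]])
  qed (use that B mult_BG_apply in auto)
  moreover have "strict_mono_on {0..1} (f \<otimes>\<^bsub>BG\<^esub> g)"
  proof (rule strict_mono_onI)
    fix x y :: real
    assume xy: "x \<in> {0..1}" "y \<in> {0..1}" "x < y"
    then have "g x < g y"
      using strict_mono_onD[OF local_PL_mono[OF assms(2)]] by blast
    then have "f (g x) < f (g y)"
      using local_PL_mono[OF assms(1)] Bij_mem[OF B(2)] xy strict_mono_onD by metis
    with xy B show "(f \<otimes>\<^bsub>BG\<^esub> g) x < (f \<otimes>\<^bsub>BG\<^esub> g) y"
      by (simp only: mult_BG_apply)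
  qed
  moreover have "f \<otimes>\<^bsub>BG\<^esub> g \<in> Bij {0..1}"
    using B BG.m_closed by (simp add: carrier_BG)
  ultimately show ?thesis
    by (simp add: local_PL_def)
qed

lemma inv_local_PL:
  assumes "f \<in> local_PL"
  shows "inv\<^bsub>BG\<^esub> f \<in> local_PL"
proof -
  let ?g = "inv\<^bsub>BG\<^esub> f"
  note B = local_PL_Bij[OF assms(1)]
  note B' = inv_BG_Bij[OF B]
  note app = inv_BG_apply[OF B]
  have m: "?g x < ?g y" if "x \<in> {0..1}" "y \<in> {0..1}" "x < y" for x y
  proof (rule ccontr)
    assume "\<not> ?g x < ?g y"
    then have "f (?g y) \<le> f (?g x)"
      using that Bij_mem[OF B'] local_PL_mono[OF assms] strict_mono_on_leD by (metis not_less)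
    with that app show False by simp
  qed
  then have mono: "strict_mono_on {0..1} ?g"
    by (rule strict_mono_onI)
  have "dyadic_PL_at ?g x" if x: "0 < x" "x < 1" for x
  proof -
    have "?g 0 = 0" "?g 1 = 1"
      using increasing_bij_ends[OF B' mono] .
    then have "0 < ?g x" "?g x < 1"
      using m[of 0 x] m[of x 1] x by auto
    then have "dyadic_PL_at ?g (f (?g x))"
      using app by (intro dyadic_PL_at_inverse[OF local_PL_at[OF assms], of _ 0 1]) auto
    then show ?thesis
      using app x by simp
  qed
  with mono B' show ?thesis
    by (simp add: local_PL_def)
qed

lemma ends_interior:
  assumes "(p, s) \<in> interval_ends"
  shows "\<forall>\<^sub>F t in at_right 0. p + s * t \<in> {0<..<1}"
  using assms eventually_at_right_real[of 0 1]
  by (auto simp: interval_ends_def elim: eventually_mono)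

lemma germ_end_mult:
  assumes "f \<in> local_PL" "g \<in> local_PL" "(p, s) \<in> interval_ends" "germ s f p k" "germ s g p l"
  shows "germ s (f \<otimes>\<^bsub>BG\<^esub> g) p (k + l)"
proof -
  note B = local_PL_Bij[OF assms(1)] local_PL_Bij[OF assms(2)]
  have p: "p \<in> {0..1}" using assms(3) by (auto simp: interval_ends_def)
  have "germ s (\<lambda>x. f (g x)) p (l + k)"
    using germ_compose[OF assms(5), of f k] assms(4) local_PL_ends[OF assms(2,3)] by simp
  then show ?thesis
    using p by (subst germ_cong[OF eventually_mono[OF ends_interior[OF assms(3)]],
          where g = "\<lambda>x. f (g x)"]) (auto simp: mult_BG_apply B add.commute)
qed

lemma germ_end_inv:
  assumes "f \<in> local_PL" "(p, s) \<in> interval_ends" "germ s f p k"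
  shows "germ s (inv\<^bsub>BG\<^esub> f) p (- k)"
proof -
  note app = inv_BG_apply[OF local_PL_Bij[OF assms(1)]]
  have "germ s (inv\<^bsub>BG\<^esub> f) (f p) (- k)"
  proof (rule germ_inverse[OF assms(3)])
    show "(inv\<^bsub>BG\<^esub> f) (f p) = p"
      using assms(2) by (intro app) (auto simp: interval_ends_def)
    show "\<forall>\<^sub>F t in at_right 0. (inv\<^bsub>BG\<^esub> f) (f (p + s * t)) = p + s * t"
      using ends_interior[OF assms(2)] by eventually_elim (simp add: app)
  qed
  then show ?thesis
    by (simp add: local_PL_ends[OF assms(1,2)])
qed

lemma germ_end_one:
  assumes "(p, s) \<in> interval_ends"
  shows "germ s \<one>\<^bsub>BG\<^esub> p 0"
proof -
  have "germ s (\<lambda>x. x) p 0" by (simp add: germ_def)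
  moreover have "p \<in> {0..1}" using assms by (auto simp: interval_ends_def)
  ultimately show ?thesis
    by (subst germ_cong[OF eventually_mono[OF ends_interior[OF assms]], where g = "\<lambda>x. x"])
      (auto simp: one_BG_apply)
qed

section \<open>The elements of F among the locally dyadic piecewise linear maps\<close>

lemma affine_germ:
  assumes "\<forall>x\<in>{u..v}. f x = 2 powi k * x + c"
  shows "u \<le> x \<Longrightarrow> x < v \<Longrightarrow> germ 1 f x k"
    and "u < x \<Longrightarrow> x \<le> v \<Longrightarrow> germ (-1) f x k"
proof -
  assume "u \<le> x" "x < v"
  moreover from this have "\<forall>\<^sub>F t in at_right 0. t \<in> {0<..<v - x}"
    by (intro eventually_at_right_real) auto
  ultimately show "germ 1 f x k"
    unfolding germ_def by (elim eventually_mono) (auto simp: assms algebra_simps)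
next
  assume "u < x" "x \<le> v"
  moreover from this have "\<forall>\<^sub>F t in at_right 0. t \<in> {0<..<x - u}"
    by (intro eventually_at_right_real) auto
  ultimately show "germ (-1) f x k"
    unfolding germ_def by (elim eventually_mono) (auto simp: assms algebra_simps)
qed

lemma finite_gap_right:
  fixes x y :: "'a::linorder"
  assumes "finite B" "x < y"
  obtains v where "x < v" "v \<le> y" "{x<..<v} \<inter> B = {}"
proof
  let ?v = "Min (insert y {b \<in> B. x < b})"
  show "x < ?v" "?v \<le> y" using assms by auto
  show "{x<..<?v} \<inter> B = {}" using assms by (auto simp: not_less)
qed

lemma finite_gap_left:
  fixes x y :: "'a::linorder"
  assumes "finite B" "y < x"
  obtains u where "y \<le> u" "u < x" "{u<..<x} \<inter> B = {}" "u \<in> insert y B"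
proof
  let ?v = "Max (insert y {b \<in> B. b < x})"
  show "?v < x" "y \<le> ?v" using assms by auto
  show "{?v<..<x} \<inter> B = {}" using assms by (auto simp: not_less)
  have "?v \<in> insert y {b \<in> B. b < x}" using assms by (intro Max_in) auto
  then show "?v \<in> insert y B" by auto
qed

text \<open>
  The definition of $F$ does not mention the constant terms of the affine pieces.  They are dyadic
  because $f(0) = 0$: the piece that ends at $x$ starts at $0$ or at a break $u$, which is dyadic and,
  by induction on the number of breaks to the left, has a dyadic image.
\<close>

lemma dyadic_PL_dyadic_iff:
  assumes "finite B" "B \<subseteq> dyadics" "f 0 = 0"
    and aff: "\<forall>u v. 0 \<le> u \<and> u < v \<and> v \<le> 1 \<and> {u<..<v} \<inter> B = {} \<longrightarrow>
        (\<exists>(k::int) c. \<forall>x\<in>{u..v}. f x = 2 powi k * x + c)"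
    and "0 \<le> x" "x \<le> (1::real)"
  shows "x \<in> dyadic_reals \<longleftrightarrow> f x \<in> dyadic_reals"
  using assms(5,6)
proof (induction "card {b \<in> B. b < x}" arbitrary: x rule: less_induct)
  case less
  show ?case
  proof (cases "x = 0")
    case True
    then show ?thesis using assms(3) by simp
  next
    case False
    then have "0 < x" using less.prems by simp
    then obtain u where u: "0 \<le> u" "u < x" "{u<..<x} \<inter> B = {}" "u \<in> insert 0 B"
      using finite_gap_left[OF assms(1)] by metis
    then have du: "u \<in> dyadic_reals"
      using assms(2) dyadic_reals_iff_dyadics[OF u(1)] by (cases "u = 0") auto
    have fu: "f u \<in> dyadic_reals"
    proof (cases "u = 0")
      case False
      then have "{b \<in> B. b < u} \<subset> {b \<in> B. b < x}" using u by auto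
      then have "card {b \<in> B. b < u} < card {b \<in> B. b < x}"
        using assms(1) by (intro psubset_card_mono) auto
      from less.hyps[OF this] u du less.prems show ?thesis by auto
    qed (use assms(3) in simp)
    obtain k c where "\<forall>y\<in>{u..x}. f y = 2 powi k * y + c"
      using aff[rule_format, of u x] u less.prems by auto
    then have "f x = f u + 2 powi k * (x - u)"
      using u by (auto simp: algebra_simps)
    then have "f x \<in> dyadic_reals \<longleftrightarrow> 2 powi k * (x - u) \<in> dyadic_reals"
      using fu dyadic_reals_add[OF fu, of "2 powi k * (x - u)"] dyadic_reals_diff[OF _ fu, of "f x"] by auto
    also have "\<dots> \<longleftrightarrow> x \<in> dyadic_reals"
      using dyadic_reals_add[OF du, of "x - u"] dyadic_reals_diff[OF _ du, of x] by auto
    finally show ?thesis by simp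
  qed
qed

lemma thompson_F_imp_local_PL:
  assumes "f \<in> carrier thompson_F"
  shows "f \<in> local_PL" "\<exists>k. germ 1 f 0 k" "\<exists>k. germ (-1) f 1 k"
proof -
  have f: "f \<in> Bij {0..1}" "strict_mono_on {0..1} f" and dpl: "dyadic_piecewise_linear f"
    using assms by (simp_all add: thompson_F_def)
  from dpl[unfolded dyadic_piecewise_linear_def] obtain B where B: "finite B" "B \<subseteq> dyadics"
    and aff': "\<forall>u v. 0 \<le> u \<and> u < v \<and> v \<le> 1 \<and> {u<..<v} \<inter> B = {} \<longrightarrow>
        (\<exists>(k::int) c. \<forall>x\<in>{u..v}. f x = 2 powi k * x + c)"
    by (elim exE conjE)
  have aff: "\<exists>(k::int) c. \<forall>x\<in>{u..v}. f x = 2 powi k * x + c"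
    if "0 \<le> u" "u < v" "v \<le> 1" "{u<..<v} \<inter> B = {}" for u v
    using aff'[rule_format, of u v] that by (simp only: simp_thms)
  note f01 = increasing_bij_ends[OF f]
  have right: "\<exists>k. germ 1 f x k" if x: "0 \<le> x" "x < 1" for x
  proof -
    obtain v where v: "x < v" "v \<le> 1" "{x<..<v} \<inter> B = {}"
      using finite_gap_right[OF B(1) x(2)] .
    with aff[of x v] x obtain k c where "\<forall>y\<in>{x..v}. f y = 2 powi k * y + c" by auto
    then show ?thesis using v by (intro exI affine_germ(1)) auto
  qed
  have left: "\<exists>k. germ (-1) f x k" if x: "0 < x" "x \<le> 1" for x
  proof -
    obtain u where u: "0 \<le> u" "u < x" "{u<..<x} \<inter> B = {}"
      using finite_gap_left[OF B(1) x(1)] .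
    with aff[of u x] x obtain k c where "\<forall>y\<in>{u..x}. f y = 2 powi k * y + c" by auto
    then show ?thesis using u by (intro exI affine_germ(2)) auto
  qed
  have iff: "x \<in> dyadic_reals \<longleftrightarrow> f x \<in> dyadic_reals" if "0 \<le> x" "x \<le> 1" for x
    using dyadic_PL_dyadic_iff[OF B f01(1) aff'] that by simp
  have "dyadic_PL_at f x" if x: "0 < x" "x < 1" for x
  proof (cases "x \<in> B")
    case True
    then have "x \<in> dyadic_reals"
      using B(2) x dyadic_reals_iff_dyadics by auto
    then show ?thesis
      unfolding dyadic_PL_at_def
      using right[of x] left[of x] iff[of x] x by simp
  next
    case False
    obtain u where u: "0 \<le> u" "u < x" "{u<..<x} \<inter> B = {}"
      using finite_gap_left[OF B(1) x(1)] .
    obtain v where v: "x < v" "v \<le> 1" "{x<..<v} \<inter> B = {}"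
      using finite_gap_right[OF B(1) x(2)] .
    have "{u<..<v} \<subseteq> {u<..<x} \<union> {x} \<union> {x<..<v}"
      by auto
    then have "{u<..<v} \<inter> B = {}"
      using u(3) v(3) False by blast
    from aff[OF u(1) _ v(2) this] u v obtain k c where "\<forall>y\<in>{u..v}. f y = 2 powi k * y + c"
      by auto
    then have "germ 1 f x k" "germ (-1) f x k"
      using u v by (auto intro!: affine_germ[of u v f k c])
    then show ?thesis
      unfolding dyadic_PL_at_def using iff[of x] x by auto
  qed
  with f show "f \<in> local_PL" by (simp add: local_PL_def)
  show "\<exists>k. germ 1 f 0 k" "\<exists>k. germ (-1) f 1 k"
    using right[of 0] left[of 1] by auto
qed

text \<open>
  Extended by the identity, the map is monotone and onto the real line, and a monotone function with
  open image is continuous.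
\<close>

lemma continuous_increasing_bij:
  assumes "f \<in> Bij {0..1::real}" "strict_mono_on {0..1} f"
  shows "continuous_on {0..1} f"
proof -
  define g where "g = (\<lambda>x. if x \<in> {0..1} then f x else x)"
  have "g ` UNIV = f ` {0..1} \<union> (UNIV - {0..1})"
    by (auto simp: g_def)
  also have "f ` {0..1} = {0..1}"
    using assms(1) by (simp add: Bij_def bij_betw_def)
  finally have "g ` UNIV = UNIV" by auto
  moreover have "g x \<le> g y" if "x \<le> y" for x y
    using that Bij_mem[OF assms(1), of x] Bij_mem[OF assms(1), of y] strict_mono_on_leD[OF assms(2), of x y]
    by (auto simp: g_def)
  ultimately have "continuous_on UNIV g"
    by (intro continuous_onI_mono) auto
  then have "continuous_on {0..1} g"
    by (rule continuous_on_subset) auto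
  then show ?thesis
    by (rule continuous_on_eq) (simp add: g_def)
qed

lemma local_PL_local_affine:
  assumes "f \<in> local_PL" "germ 1 f 0 i" "germ (-1) f 1 j" "x \<in> {0..1}"
  obtains e k l where "e > 0"
    "\<And>y. y \<in> {0..1} \<Longrightarrow> x \<le> y \<Longrightarrow> y < x + e \<Longrightarrow> f y = f x + 2 powi k * (y - x)"
    "\<And>y. y \<in> {0..1} \<Longrightarrow> y \<le> x \<Longrightarrow> x - e < y \<Longrightarrow> f y = f x + 2 powi l * (y - x)"
    "x \<notin> dyadic_reals \<Longrightarrow> k = l"
proof -
  have gr: "\<exists>e>0. \<forall>y. x \<le> y \<longrightarrow> y < x + e \<longrightarrow> f y = f x + 2 powi k * (y - x)"
    if "germ 1 f x k" for k
  proof -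
    from that obtain e where e: "e > 0" "\<And>t. 0 < t \<Longrightarrow> t < e \<Longrightarrow> f (x + t) = f x + 2 powi k * t"
      unfolding germ_def eventually_at_right_field by auto
    have "f y = f x + 2 powi k * (y - x)" if "x \<le> y" "y < x + e" for y
      using e(2)[of "y - x"] that by (cases "x = y") auto
    with e(1) show ?thesis by blast
  qed
  have gl: "\<exists>e>0. \<forall>y. y \<le> x \<longrightarrow> x - e < y \<longrightarrow> f y = f x + 2 powi k * (y - x)"
    if "germ (-1) f x k" for k
  proof -
    from that obtain e where e: "e > 0" "\<And>t. 0 < t \<Longrightarrow> t < e \<Longrightarrow> f (x - t) = f x - 2 powi k * t"
      unfolding germ_def eventually_at_right_field by auto
    have "f y = f x + 2 powi k * (y - x)" if "y \<le> x" "x - e < y" for y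
      using e(2)[of "x - y"] that by (cases "x = y") (auto simp: algebra_simps)
    with e(1) show ?thesis by blast
  qed
  consider "x = 0" | "x = 1" | "0 < x" "x < 1" using assms(4) by fastforce
  then show thesis
  proof cases
    case 1
    then have "germ 1 f x i" using assms(2) by simp
    from gr[OF this] obtain e where
      e: "e > 0" "\<And>y. x \<le> y \<Longrightarrow> y < x + e \<Longrightarrow> f y = f x + 2 powi i * (y - x)" by blast
    show thesis
    proof (rule that[OF e(1)])
      show "f y = f x + 2 powi i * (y - x)" if "x \<le> y" "y < x + e" for y
        using that by (rule e(2))
      show "f y = f x + 2 powi i * (y - x)" if "y \<in> {0..1}" "y \<le> x" for y
      proof -
        have "y = x" using that 1 by simp
        then show ?thesis by simp
      qed
    qed simp
  next
    case 2
    then have "germ (-1) f x j" using assms(3) by simp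
    from gl[OF this] obtain e where
      e: "e > 0" "\<And>y. y \<le> x \<Longrightarrow> x - e < y \<Longrightarrow> f y = f x + 2 powi j * (y - x)" by blast
    show thesis
    proof (rule that[OF e(1)])
      show "f y = f x + 2 powi j * (y - x)" if "y \<le> x" "x - e < y" for y
        using that by (rule e(2))
      show "f y = f x + 2 powi j * (y - x)" if "y \<in> {0..1}" "x \<le> y" for y
      proof -
        have "y = x" using that 2 by simp
        then show ?thesis by simp
      qed
    qed simp
  next
    case 3
    from local_PL_at[OF assms(1) 3] obtain k l where
      kl: "germ 1 f x k" "germ (-1) f x l" "x \<notin> dyadic_reals \<longrightarrow> k = l"
      unfolding dyadic_PL_at_def by blast
    from gr[OF kl(1)] obtain e where
      e: "e > 0" "\<And>y. x \<le> y \<Longrightarrow> y < x + e \<Longrightarrow> f y = f x + 2 powi k * (y - x)" by blast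
    from gl[OF kl(2)] obtain e' where
      e': "e' > 0" "\<And>y. y \<le> x \<Longrightarrow> x - e' < y \<Longrightarrow> f y = f x + 2 powi l * (y - x)" by blast
    show thesis
    proof (rule that[of "min e e'" k l])
      show "f y = f x + 2 powi k * (y - x)" if "x \<le> y" "y < x + min e e'" for y
        using that by (intro e(2)) auto
      show "f y = f x + 2 powi l * (y - x)" if "y \<le> x" "x - min e e' < y" for y
        using that by (intro e'(2)) auto
    qed (use e(1) e'(1) kl(3) in auto)
  qed
qed

text \<open>
  Compactness: near every point there is at most one break, so finitely many breaks suffice.  The
  argument is run as a bisection with \<open>Bolzano\<close>, where adjacent intervals are joined by adding the
  common end point to the breaks if it is dyadic; if it is not, the slopes on its two sides agree.
\<close>

lemma local_PL_imp_dyadic_piecewise_linear: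
  assumes "f \<in> local_PL" "germ 1 f 0 i" "germ (-1) f 1 j"
  shows "dyadic_piecewise_linear f"
proof -
  define Q where "Q a b B \<longleftrightarrow> (\<forall>u v. a \<le> u \<and> u < v \<and> v \<le> b \<and> {u<..<v} \<inter> B = {} \<longrightarrow>
      (\<exists>(k::int) c. \<forall>x\<in>{u..v}. f x = 2 powi k * x + c))" for a b :: real and B
  define P where "P a b \<longleftrightarrow> (0 \<le> a \<and> b \<le> 1 \<longrightarrow> (\<exists>B. finite B \<and> B \<subseteq> dyadics \<and> Q a b B))"
    for a b :: real
  have "P 0 1"
  proof (rule Bolzano[where P = P])
    fix a b c assume trans: "P a b" "P b c" "a \<le> b" "b \<le> c"
    show "P a c" unfolding P_def
    proof
      assume ac: "0 \<le> a \<and> c \<le> 1"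
      obtain B where B: "finite B" "B \<subseteq> dyadics" "Q a b B"
        using trans ac unfolding P_def by auto
      obtain C where C: "finite C" "C \<subseteq> dyadics" "Q b c C"
        using trans ac unfolding P_def by auto
      have QD: "\<exists>(k::int) c. \<forall>x\<in>{u..v}. f x = 2 powi k * x + c"
        if "Q a b B" "a \<le> u" "u < v" "v \<le> b" "{u<..<v} \<inter> B = {}" for a b B u v
        using that unfolding Q_def by blast
      let ?B = "B \<union> C \<union> ({b} \<inter> dyadics)"
      have "\<exists>(k::int) c. \<forall>x\<in>{u..v}. f x = 2 powi k * x + c"
        if uv: "a \<le> u" "u < v" "v \<le> c" "{u<..<v} \<inter> ?B = {}" for u v
      proof -
        consider "v \<le> b" | "b \<le> u" | "u < b" "b < v" by fastforce
        then show ?thesis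
        proof cases
          case 1
          then show ?thesis using uv by (intro QD[OF B(3)]) auto
        next
          case 2
          then show ?thesis using uv by (intro QD[OF C(3)]) auto
        next
          case 3
          have sub: "{u<..<b} \<subseteq> {u<..<v}" "{b<..<v} \<subseteq> {u<..<v}" "b \<in> {u<..<v}"
            using 3 by auto
          have BC: "{u<..<b} \<inter> B = {}" "{b<..<v} \<inter> C = {}" and nd: "b \<notin> dyadics"
            using uv(4) sub by blast+
          obtain k d where aff1: "\<forall>x\<in>{u..b}. f x = 2 powi k * x + d"
            using QD[OF B(3) uv(1) 3(1) order_refl BC(1)] by blast
          obtain k' d' where aff2: "\<forall>x\<in>{b..v}. f x = 2 powi k' * x + d'"
            using QD[OF C(3) order_refl 3(2) uv(3) BC(2)] by blast
          have g: "germ (-1) f b k" "germ 1 f b k'"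
            using affine_germ(2)[OF aff1, of b] affine_germ(1)[OF aff2, of b] 3 by auto
          have b: "0 < b" "b < 1" using uv 3 ac by auto
          then have "b \<notin> dyadic_reals" using nd dyadic_reals_iff_dyadics by auto
          then obtain m where "germ 1 f b m" "germ (-1) f b m"
            using local_PL_at[OF assms(1) b] by (auto simp: dyadic_PL_at_def)
          then have "k = k'"
            using g germ_unique[of "-1" f b k m] germ_unique[of 1 f b k' m] by auto
          moreover from this have "d = d'"
            using aff1[rule_format, of b] aff2[rule_format, of b] 3 by simp
          ultimately have "f x = 2 powi k * x + d" if "x \<in> {u..v}" for x
            using aff1[rule_format, of x] aff2[rule_format, of x] that by (cases "x \<le> b") auto
          then show ?thesis by blast
        qed
      qed
      then have "Q a c ?B"
        unfolding Q_def by blast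
      then show "\<exists>B. finite B \<and> B \<subseteq> dyadics \<and> Q a c B"
        using B(1,2) C(1,2) by (intro exI[of _ ?B]) auto
    qed
  next
    fix x :: real assume "0 \<le> x" "x \<le> 1"
    then have x: "x \<in> {0..1}" by auto
    from local_PL_local_affine[OF assms this] obtain e k l where e: "e > 0"
      and R: "\<And>y. y \<in> {0..1} \<Longrightarrow> x \<le> y \<Longrightarrow> y < x + e \<Longrightarrow> f y = f x + 2 powi k * (y - x)"
      and L: "\<And>y. y \<in> {0..1} \<Longrightarrow> y \<le> x \<Longrightarrow> x - e < y \<Longrightarrow> f y = f x + 2 powi l * (y - x)"
      and kl: "x \<notin> dyadic_reals \<Longrightarrow> k = l"
      by metis
    have "P a b" if ab: "a \<le> x" "x \<le> b" "b - a < e" for a b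
      unfolding P_def
    proof
      assume ab': "0 \<le> a \<and> b \<le> 1"
      have "\<exists>(k::int) c. \<forall>x\<in>{u..v}. f x = 2 powi k * x + c"
        if uv: "a \<le> u" "u < v" "v \<le> b" "{u<..<v} \<inter> ({x} \<inter> dyadics) = {}" for u v
      proof -
        have R': "f y = 2 powi k * y + (f x - 2 powi k * x)" if "y \<in> {u..v}" "x \<le> y" for y
          using R[of y] that uv ab ab' by (auto simp: algebra_simps)
        have L': "f y = 2 powi l * y + (f x - 2 powi l * x)" if "y \<in> {u..v}" "y \<le> x" for y
          using L[of y] that uv ab ab' by (auto simp: algebra_simps)
        consider "x \<le> u" | "v \<le> x" | "x \<notin> dyadics"
          using uv by fastforce
        then show ?thesis
        proof cases
          case 1
          then show ?thesis using R' by (intro exI[of _ k] exI ballI) auto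
        next
          case 2
          then show ?thesis using L' by (intro exI[of _ l] exI ballI) auto
        next
          case 3
          then have "k = l" using kl x dyadic_reals_iff_dyadics by auto
          then have "f y = 2 powi k * y + (f x - 2 powi k * x)" if "y \<in> {u..v}" for y
            using R'[OF that] L'[OF that] by (cases "x \<le> y") auto
          then show ?thesis by blast
        qed
      qed
      then have "Q a b ({x} \<inter> dyadics)"
        unfolding Q_def by blast
      then show "\<exists>B. finite B \<and> B \<subseteq> dyadics \<and> Q a b B"
        by (intro exI[of _ "{x} \<inter> dyadics"]) auto
    qed
    with e show "\<exists>d>0. \<forall>a b. a \<le> x \<and> x \<le> b \<and> b - a < d \<longrightarrow> P a b" by blast
  qed simp
  then show ?thesis
    unfolding P_def Q_def dyadic_piecewise_linear_def by simp
qed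

text \<open>
  Membership in $F$ is a local condition in the interior together with affinity near the two ends.
  In this form closure under composition, inversion, reflection and conjugation follows from the
  corresponding facts for germs.
\<close>

lemma carrier_thompson_F:
  "carrier thompson_F = {f \<in> local_PL. \<forall>(p, s) \<in> interval_ends. \<exists>k. germ s f p k}"
proof (intro equalityI subsetI)
  fix f assume "f \<in> carrier thompson_F"
  from thompson_F_imp_local_PL[OF this]
  show "f \<in> {f \<in> local_PL. \<forall>(p, s) \<in> interval_ends. \<exists>k. germ s f p k}"
    by (auto simp: interval_ends_def)
next
  fix f assume f: "f \<in> {f \<in> local_PL. \<forall>(p, s) \<in> interval_ends. \<exists>k. germ s f p k}"
  then obtain i j where "f \<in> local_PL" "germ 1 f 0 i" "germ (-1) f 1 j"
    by (auto simp: interval_ends_def)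
  then have "dyadic_piecewise_linear f" and B: "f \<in> Bij {0..1}" and m: "strict_mono_on {0..1} f"
    using local_PL_imp_dyadic_piecewise_linear by (auto simp: local_PL_def)
  moreover have "\<exists>g. homeomorphism {0..1} {0..1} f g"
    using B continuous_increasing_bij[OF B m]
    by (intro homeomorphism_compact) (auto simp: Bij_def bij_betw_def)
  ultimately show "f \<in> carrier thompson_F"
    by (simp add: thompson_F_def)
qed

section \<open>Conjugators that rescale the end slopes\<close>

text \<open>
  Near the end $p$ the map intertwines multiplication by $2^k$ with multiplication by $2^{ak}$, where
  distances are measured from $p$.
\<close>

definition end_scaling :: "real \<Rightarrow> real \<Rightarrow> int \<Rightarrow> (real \<Rightarrow> real) \<Rightarrow> bool" where
  "end_scaling s p a \<theta> \<longleftrightarrow> (\<forall>k. \<forall>\<^sub>F t in at_right 0.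
     \<theta> (p + s * (2 powi k * t)) - p = 2 powi (a * k) * (\<theta> (p + s * t) - p))"

lemma end_scalingD:
  "end_scaling s p a \<theta> \<Longrightarrow> \<forall>\<^sub>F t in at_right 0.
     \<theta> (p + s * (2 powi k * t)) - p = 2 powi (a * k) * (\<theta> (p + s * t) - p)"
  unfolding end_scaling_def by blast

lemma interval_ends_mem: "(p, s) \<in> interval_ends \<Longrightarrow> p \<in> {0..1}"
  and interval_ends_sq: "(p, s) \<in> interval_ends \<Longrightarrow> s * (s * x) = x"
  by (auto simp: interval_ends_def)

lemma end_approach:
  assumes "f \<in> local_PL" "(p, s) \<in> interval_ends"
  shows "filterlim (\<lambda>t. s * (f (p + s * t) - p)) (at_right 0) (at_right 0)"
proof (rule tendsto_imp_filterlim_at_right)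
  have "continuous_on {0..1} f"
    using assms(1) by (intro continuous_increasing_bij local_PL_Bij local_PL_mono)
  then have "((\<lambda>t. f (p + s * t)) \<longlongrightarrow> f p) (at_right 0)"
  proof (rule continuous_on_tendsto_compose)
    show "((\<lambda>t. p + s * t) \<longlongrightarrow> p) (at_right 0)"
      by (auto intro!: tendsto_eq_intros)
    show "\<forall>\<^sub>F t in at_right 0. p + s * t \<in> {0..1}"
      using ends_interior[OF assms(2)] by eventually_elim auto
  qed (rule interval_ends_mem[OF assms(2)])
  then show "((\<lambda>t. s * (f (p + s * t) - p)) \<longlongrightarrow> 0) (at_right 0)"
    using local_PL_ends[OF assms] by (auto intro!: tendsto_eq_intros)
  show "\<forall>\<^sub>F t in at_right 0. 0 < s * (f (p + s * t) - p)"
    using ends_interior[OF assms(2)]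
  proof eventually_elim
    case (elim t)
    then have "f (p + s * t) \<in> {0<..<1}"
      using local_PL_interior[OF assms(1)] by auto
    with assms(2) show ?case
      by (auto simp: interval_ends_def)
  qed
qed

text \<open>
  A linear map commutes with every multiplication.
\<close>

lemma germ_imp_end_scaling:
  assumes "germ s f p l" "f p = p"
  shows "end_scaling s p 1 f"
  unfolding end_scaling_def
proof
  fix k
  have "\<forall>\<^sub>F t in at_right 0. f (p + s * (2 powi k * t)) = f p + s * (2 powi l * (2 powi k * t))"
    using assms(1) unfolding germ_def by (rule eventually_at_right_0_scale[rotated]) simp
  with assms(1)[unfolded germ_def]
  show "\<forall>\<^sub>F t in at_right 0. f (p + s * (2 powi k * t)) - p = 2 powi (1 * k) * (f (p + s * t) - p)"
    by eventually_elim (simp add: assms(2))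
qed

lemma end_scaling_mult:
  assumes "f \<in> local_PL" "g \<in> local_PL" "(p, s) \<in> interval_ends"
    "end_scaling s p a f" "end_scaling s p b g"
  shows "end_scaling s p (a * b) (f \<otimes>\<^bsub>BG\<^esub> g)"
  unfolding end_scaling_def
proof
  fix k
  note app = mult_BG_apply[OF local_PL_Bij[OF assms(1)] local_PL_Bij[OF assms(2)]]
  let ?w = "\<lambda>t. s * (g (p + s * t) - p)"
  have w: "p + s * ?w t = g (p + s * t)" for t
    unfolding interval_ends_sq[OF assms(3)] by simp
  have "\<forall>\<^sub>F t in at_right 0. f (p + s * (2 powi (b * k) * ?w t)) - p = 2 powi (a * (b * k)) * (f (p + s * ?w t) - p)"
    using end_scalingD[OF assms(4)] end_approach[OF assms(2,3)] by (rule eventually_compose_filterlim)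
  moreover have "\<forall>\<^sub>F t in at_right 0. g (p + s * (2 powi k * t)) - p = 2 powi (b * k) * (g (p + s * t) - p)"
    by (rule end_scalingD[OF assms(5)])
  moreover have "\<forall>\<^sub>F t in at_right 0. p + s * (2 powi k * t) \<in> {0<..<1}"
    using ends_interior[OF assms(3)] by (rule eventually_at_right_0_scale[rotated]) simp
  ultimately show "\<forall>\<^sub>F t in at_right 0. (f \<otimes>\<^bsub>BG\<^esub> g) (p + s * (2 powi k * t)) - p =
      2 powi (a * b * k) * ((f \<otimes>\<^bsub>BG\<^esub> g) (p + s * t) - p)"
    using ends_interior[OF assms(3)]
  proof eventually_elim
    case (elim t)
    have "s * (2 powi (b * k) * ?w t) = g (p + s * (2 powi k * t)) - p"
      using elim(2) assms(3) by (auto simp: interval_ends_def)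
    then have "p + s * (2 powi (b * k) * ?w t) = g (p + s * (2 powi k * t))" by simp
    with elim(1) w have "f (g (p + s * (2 powi k * t))) - p = 2 powi (a * (b * k)) * (f (g (p + s * t)) - p)"
      by simp
    moreover have "p + s * (2 powi k * t) \<in> {0..1}" "p + s * t \<in> {0..1}"
      using elim(3,4) by auto
    ultimately show ?case
      by (simp only: app mult.assoc)
  qed
qed

text \<open>
  Write $\eta$ for the inverse of $\theta$.  Near $p$ the map $g$ multiplies distances by $2^k$, so
  $\theta \circ g \circ \eta$ multiplies the distance of $\theta(\eta(x)) = x$ by $2^{ak}$.
\<close>

lemma germ_conj:
  assumes "\<theta> \<in> local_PL" "g \<in> local_PL" "(p, s) \<in> interval_ends"
    "end_scaling s p a \<theta>" "germ s g p k"
  shows "germ s (\<theta> \<otimes>\<^bsub>BG\<^esub> g \<otimes>\<^bsub>BG\<^esub> inv\<^bsub>BG\<^esub> \<theta>) p (a * k)"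
proof -
  define \<eta> where "\<eta> = inv\<^bsub>BG\<^esub> \<theta>"
  have \<eta>: "\<eta> \<in> local_PL" unfolding \<eta>_def by (rule inv_local_PL[OF assms(1)])
  note B = local_PL_Bij[OF assms(1)] local_PL_Bij[OF assms(2)] local_PL_Bij[OF \<eta>]
  have app: "(\<theta> \<otimes>\<^bsub>BG\<^esub> g \<otimes>\<^bsub>BG\<^esub> \<eta>) x = \<theta> (g (\<eta> x))" if "x \<in> {0..1}" for x
    using mult_BG_apply[OF local_PL_Bij[OF mult_local_PL[OF assms(1,2)]] B(3) that]
      mult_BG_apply[OF B(1) B(2) Bij_mem[OF B(3) that]] by simp
  let ?u = "\<lambda>t. s * (\<eta> (p + s * t) - p)"
  have u: "p + s * ?u t = \<eta> (p + s * t)" for t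
    unfolding interval_ends_sq[OF assms(3)] by simp
  note lim = end_approach[OF \<eta> assms(3)]
  have "\<forall>\<^sub>F t in at_right 0. g (p + s * ?u t) = g p + s * (2 powi k * ?u t)"
    using assms(5) lim unfolding germ_def by (rule eventually_compose_filterlim)
  moreover have "\<forall>\<^sub>F t in at_right 0. \<theta> (p + s * (2 powi k * ?u t)) - p = 2 powi (a * k) * (\<theta> (p + s * ?u t) - p)"
    using end_scalingD[OF assms(4)] lim by (rule eventually_compose_filterlim)
  ultimately have ev: "\<forall>\<^sub>F t in at_right 0. (\<theta> \<otimes>\<^bsub>BG\<^esub> g \<otimes>\<^bsub>BG\<^esub> \<eta>) (p + s * t) = p + s * (2 powi (a * k) * t)"
    using ends_interior[OF assms(3)]
  proof eventually_elim
    case (elim t)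
    then have I: "p + s * t \<in> {0..1}" by auto
    have "\<theta> (\<eta> (p + s * t)) = p + s * t"
      unfolding \<eta>_def by (rule inv_BG_apply[OF B(1) I])
    then have "\<theta> (p + s * ?u t) = p + s * t"
      by (simp only: u)
    with elim(2) have "\<theta> (p + s * (2 powi k * ?u t)) - p = 2 powi (a * k) * (p + s * t - p)"
      by (simp only:)
    then have "\<theta> (p + s * (2 powi k * ?u t)) = p + s * (2 powi (a * k) * t)"
      by (simp only: diff_eq_eq add_diff_cancel_left' mult.left_commute add.commute)
    moreover have "g (\<eta> (p + s * t)) = p + s * (2 powi k * ?u t)"
      using elim(1) by (simp only: u local_PL_ends[OF assms(2,3)])
    ultimately show ?case
      by (simp only: app[OF I])
  qed
  have "\<theta> \<otimes>\<^bsub>BG\<^esub> g \<otimes>\<^bsub>BG\<^esub> \<eta> \<in> local_PL"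
    using mult_local_PL assms(1,2) \<eta> by blast
  then show ?thesis
    using ev unfolding germ_def \<eta>_def[symmetric] by (simp only: local_PL_ends[OF _ assms(3)])
qed

text \<open>
  This is where a slope exponent that is a multiple of $a$ is needed: only then does scaling by it
  pull back through $\theta$ to scaling by a power of two.
\<close>

lemma germ_conj_inverse:
  assumes "\<theta> \<in> local_PL" "f \<in> local_PL" "(p, s) \<in> interval_ends"
    "end_scaling s p a \<theta>" "germ s f p (a * k)"
  shows "germ s (inv\<^bsub>BG\<^esub> \<theta> \<otimes>\<^bsub>BG\<^esub> f \<otimes>\<^bsub>BG\<^esub> \<theta>) p k"
proof -
  define \<eta> where "\<eta> = inv\<^bsub>BG\<^esub> \<theta>"
  have \<eta>: "\<eta> \<in> local_PL" unfolding \<eta>_def by (rule inv_local_PL[OF assms(1)])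
  note B = local_PL_Bij[OF assms(1)] local_PL_Bij[OF assms(2)] local_PL_Bij[OF \<eta>]
  have app: "(\<eta> \<otimes>\<^bsub>BG\<^esub> f \<otimes>\<^bsub>BG\<^esub> \<theta>) x = \<eta> (f (\<theta> x))" if "x \<in> {0..1}" for x
    using mult_BG_apply[OF local_PL_Bij[OF mult_local_PL[OF \<eta> assms(2)]] B(1) that]
      mult_BG_apply[OF B(3) B(2) Bij_mem[OF B(1) that]] by simp
  let ?v = "\<lambda>t. s * (\<theta> (p + s * t) - p)"
  have v: "p + s * ?v t = \<theta> (p + s * t)" for t
    unfolding interval_ends_sq[OF assms(3)] by simp
  have "\<forall>\<^sub>F t in at_right 0. f (p + s * ?v t) = f p + s * (2 powi (a * k) * ?v t)"
    using assms(5) end_approach[OF assms(1,3)] unfolding germ_def by (rule eventually_compose_filterlim)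
  moreover have "\<forall>\<^sub>F t in at_right 0. \<theta> (p + s * (2 powi k * t)) - p = 2 powi (a * k) * (\<theta> (p + s * t) - p)"
    by (rule end_scalingD[OF assms(4)])
  moreover have "\<forall>\<^sub>F t in at_right 0. p + s * (2 powi k * t) \<in> {0<..<1}"
    using ends_interior[OF assms(3)] by (rule eventually_at_right_0_scale[rotated]) simp
  ultimately have ev: "\<forall>\<^sub>F t in at_right 0. (\<eta> \<otimes>\<^bsub>BG\<^esub> f \<otimes>\<^bsub>BG\<^esub> \<theta>) (p + s * t) = p + s * (2 powi k * t)"
    using ends_interior[OF assms(3)]
  proof eventually_elim
    case (elim t)
    then have I: "p + s * t \<in> {0..1}" "p + s * (2 powi k * t) \<in> {0..1}" by auto
    have "s * (2 powi (a * k) * ?v t) = 2 powi (a * k) * (\<theta> (p + s * t) - p)"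
      using assms(3) by (auto simp: interval_ends_def)
    with elim(1,2) have "f (\<theta> (p + s * t)) = \<theta> (p + s * (2 powi k * t))"
      by (simp add: v local_PL_ends[OF assms(2,3)])
    moreover have "\<eta> (\<theta> (p + s * (2 powi k * t))) = p + s * (2 powi k * t)"
      unfolding \<eta>_def by (rule inv_BG_apply[OF B(1) I(2)])
    ultimately show ?case
      by (simp only: app[OF I(1)])
  qed
  have "\<eta> \<otimes>\<^bsub>BG\<^esub> f \<otimes>\<^bsub>BG\<^esub> \<theta> \<in> local_PL"
    using mult_local_PL assms(1,2) \<eta> by blast
  then show ?thesis
    using ev unfolding germ_def \<eta>_def[symmetric] by (simp only: local_PL_ends[OF _ assms(3)])
qed

text \<open>
  The flip of the interval exchanges its two ends, so a construction at $0$ also serves at $1$.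
\<close>

definition reflect :: "(real \<Rightarrow> real) \<Rightarrow> real \<Rightarrow> real" where
  "reflect f = (\<lambda>x\<in>{0..1}. 1 - f (1 - x))"

lemma reflect_apply: "x \<in> {0..1} \<Longrightarrow> reflect f x = 1 - f (1 - x)"
  by (simp add: reflect_def)

lemma reflect_local_PL:
  assumes "f \<in> local_PL"
  shows "reflect f \<in> local_PL"
proof -
  have r: "bij_betw (\<lambda>x::real. 1 - x) {0..1} {0..1}"
    by (rule bij_betw_byWitness[where f' = "\<lambda>x. 1 - x"]) auto
  have "bij_betw f {0..1} {0..1}"
    using local_PL_Bij[OF assms] by (simp add: Bij_def)
  then have "bij_betw ((\<lambda>x. 1 - x) \<circ> (f \<circ> (\<lambda>x. 1 - x))) {0..1} {0..1}"
    by (intro bij_betw_trans[OF _ r] bij_betw_trans[OF r])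
  then have "bij_betw (reflect f) {0..1} {0..1}"
    by (rule bij_betw_cong[THEN iffD1, rotated]) (simp add: reflect_def)
  moreover have "strict_mono_on {0..1} (reflect f)"
  proof (rule strict_mono_onI)
    fix x y :: real
    assume "x \<in> {0..1}" "y \<in> {0..1}" "x < y"
    then show "reflect f x < reflect f y"
      using strict_mono_onD[OF local_PL_mono[OF assms], of "1 - y" "1 - x"]
      by (simp add: reflect_apply)
  qed
  moreover have "dyadic_PL_at (reflect f) x" if "0 < x" "x < 1" for x
    using that dyadic_PL_at_reflect[OF local_PL_at[OF assms]]
    by (subst dyadic_PL_at_cong[of 0 1 _ "\<lambda>x. 1 - f (1 - x)"]) (auto simp: reflect_apply)
  ultimately show ?thesis
    by (simp add: local_PL_def Bij_def reflect_def)
qed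

lemma interval_ends_reflect: "(p, s) \<in> interval_ends \<Longrightarrow> (1 - p, - s) \<in> interval_ends"
  by (auto simp: interval_ends_def)

lemma germ_end_reflect:
  assumes "(p, s) \<in> interval_ends" "germ s f p k"
  shows "germ (- s) (reflect f) (1 - p) k"
proof -
  have "germ (- s) (\<lambda>x. 1 - f (1 - x)) (1 - p) k"
    using assms(2) by (simp add: germ_reflect)
  moreover have "1 - p \<in> {0..1}"
    using interval_ends_mem[OF assms(1)] by simp
  ultimately show ?thesis
    by (subst germ_cong[OF eventually_mono[OF ends_interior[OF interval_ends_reflect[OF assms(1)]]],
          where g = "\<lambda>x. 1 - f (1 - x)"]) (simp_all add: reflect_apply)
qed

lemma end_scaling_reflect:
  assumes "(p, s) \<in> interval_ends" "end_scaling s p a f"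
  shows "end_scaling (- s) (1 - p) a (reflect f)"
  unfolding end_scaling_def
proof
  fix k
  have ends: "\<forall>\<^sub>F t in at_right 0. 1 - p + - s * t \<in> {0<..<1}"
    by (rule ends_interior[OF interval_ends_reflect[OF assms(1)]])
  have ends': "\<forall>\<^sub>F t in at_right 0. 1 - p + - s * (2 powi k * t) \<in> {0<..<1}"
    using ends by (rule eventually_at_right_0_scale[rotated]) simp
  have "\<forall>\<^sub>F t in at_right 0. f (p + s * (2 powi k * t)) - p = 2 powi (a * k) * (f (p + s * t) - p)"
    by (rule end_scalingD[OF assms(2)])
  with ends ends' show "\<forall>\<^sub>F t in at_right 0. reflect f (1 - p + - s * (2 powi k * t)) - (1 - p) =
      2 powi (a * k) * (reflect f (1 - p + - s * t) - (1 - p))"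
  proof eventually_elim
    case (elim t)
    then have "1 - p + - s * t \<in> {0..1}" "1 - p + - s * (2 powi k * t) \<in> {0..1}" by auto
    then have r: "reflect f (1 - p + - s * (2 powi k * t)) = 1 - f (p + s * (2 powi k * t))"
      "reflect f (1 - p + - s * t) = 1 - f (p + s * t)"
      by (simp_all only: reflect_apply) (simp_all add: algebra_simps)
    show ?case
      unfolding r using elim(3) by (simp add: algebra_simps)
  qed
qed

section \<open>Construction of a conjugator\<close>

text \<open>
  A fundamental domain for $x \mapsto 2x$ is $[1,2]$ and one for $x \mapsto 2^a x$ is $[1,2^a]$.  The
  bend maps the first onto the second with only two slopes, $2^{a-1}$ and $2^a$; the break is placed
  where the lengths add up: $2^{1-a} \cdot 2^{a-1} + (1 - 2^{1-a}) \cdot 2^a = 2^a - 1$.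
\<close>

definition bend :: "int \<Rightarrow> real \<Rightarrow> real" where
  "bend a z = max (1 + 2 powi (a - 1) * (z - 1)) (2 powi a * (z - 1))"

definition bend_break :: "int \<Rightarrow> real" where
  "bend_break a = 1 + 2 powi (1 - a)"

lemma powi_pred_mult: "(2::real) powi a = 2 * 2 powi (a - 1)"
  by (simp add: power_int_diff)

lemma powi_cancel [simp]:
  "(2::real) powi n * (2 powi (- n) * x) = x" "(2::real) powi (- n) * (2 powi n * x) = x"
  by (simp_all add: mult.assoc[symmetric] power_int_add[symmetric])

lemma bend_below: "z \<le> bend_break a \<Longrightarrow> bend a z = 1 + 2 powi (a - 1) * (z - 1)"
  and bend_above: "bend_break a \<le> z \<Longrightarrow> bend a z = 2 powi a * (z - 1)"
proof -
  have one: "(2::real) powi (a - 1) * 2 powi (1 - a) = 1"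
    by (simp add: power_int_add[symmetric])
  have diff: "2 powi a * (z - 1) - (1 + 2 powi (a - 1) * (z - 1)) = 2 powi (a - 1) * (z - bend_break a)" for z
    using one by (simp add: bend_break_def powi_pred_mult[of a] algebra_simps)
  show "bend a z = 1 + 2 powi (a - 1) * (z - 1)" if "z \<le> bend_break a"
  proof -
    have "2 powi (a - 1) * (z - bend_break a) \<le> 0"
      using that by (intro mult_nonneg_nonpos) auto
    with diff[of z] show ?thesis by (simp add: bend_def)
  qed
  show "bend a z = 2 powi a * (z - 1)" if "bend_break a \<le> z"
  proof -
    have "2 powi (a - 1) * (z - bend_break a) \<ge> 0"
      using that by (intro mult_nonneg_nonneg) auto
    with diff[of z] show ?thesis by (simp add: bend_def)
  qed
qed

lemma bend_mono:
  assumes "x < y"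
  shows "bend a x < bend a y"
proof -
  have "2 powi k * (x - 1) < 2 powi k * (y - 1)" for k
    using assms by simp
  from this[of "a - 1"] this[of a] show ?thesis
    unfolding bend_def by linarith
qed

lemma bend_1: "bend a 1 = 1"
  by (simp add: bend_def)

lemma bend_2:
  assumes "a \<ge> 1"
  shows "bend a 2 = 2 powi a"
proof -
  have "(1::real) \<le> 2 powi (a - 1)" using assms by simp
  then show ?thesis
    by (simp add: bend_def powi_pred_mult[of a])
qed

text \<open>
  The bend is a maximum of two increasing affine maps, so its inverse is the minimum of their
  inverses.
\<close>

lemma bend_surj:
  assumes "1 \<le> w" "w < 2 powi a" "a \<ge> 1"
  obtains z where "1 \<le> z" "z < 2" "bend a z = w"
proof -
  let ?z = "min (1 + 2 powi (1 - a) * (w - 1)) (1 + 2 powi (- a) * w)"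
  have m: "(2::real) powi (a - 1) * (2 powi (1 - a) * x) = x" "(2::real) powi a * (2 powi (- a) * x) = x" for x
    by (simp_all add: mult.assoc[symmetric] power_int_add[symmetric])
  have "bend a ?z = w"
  proof (cases "1 + 2 powi (1 - a) * (w - 1) \<le> 1 + 2 powi (- a) * w")
    case True
    then have z: "?z = 1 + 2 powi (1 - a) * (w - 1)" by simp
    from True have "2 powi a * (2 powi (1 - a) * (w - 1)) \<le> 2 powi a * (2 powi (- a) * w)"
      by (intro mult_left_mono) auto
    then show ?thesis
      unfolding z bend_def by (simp add: m)
  next
    case False
    then have z: "?z = 1 + 2 powi (- a) * w" by simp
    from False have "2 powi (a - 1) * (2 powi (- a) * w) \<le> 2 powi (a - 1) * (2 powi (1 - a) * (w - 1))"
      by (intro mult_left_mono) auto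
    then show ?thesis
      unfolding z bend_def by (simp add: m)
  qed
  moreover have "1 \<le> ?z"
    using assms by auto
  moreover have "?z < 2"
    using bend_mono[of 2 ?z a] bend_2[OF assms(3)] assms(2) \<open>bend a ?z = w\<close>
    by (cases "?z" "2::real" rule: linorder_cases) auto
  ultimately show thesis using that by blast
qed

lemma bend_break_dyadic: "bend_break a \<in> dyadic_reals"
  unfolding bend_break_def by (intro dyadic_reals_add) auto

lemma bend_right_germ:
  "z < bend_break a \<Longrightarrow> germ 1 (bend a) z (a - 1)"
  "bend_break a \<le> z \<Longrightarrow> germ 1 (bend a) z a"
  using affine_germ(1)[of z "bend_break a" "bend a" "a - 1" "1 - 2 powi (a - 1)" z]
    affine_germ(1)[of z "z + 1" "bend a" a "- (2 powi a)" z]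
  by (auto simp: bend_below bend_above algebra_simps)

lemma bend_left_germ:
  "z \<le> bend_break a \<Longrightarrow> germ (-1) (bend a) z (a - 1)"
  "bend_break a < z \<Longrightarrow> germ (-1) (bend a) z a"
  using affine_germ(2)[of "z - 1" z "bend a" "a - 1" "1 - 2 powi (a - 1)" z]
    affine_germ(2)[of "bend_break a" z "bend a" a "- (2 powi a)" z]
  by (auto simp: bend_below bend_above algebra_simps)

lemma bend_dyadic_iff: "bend a z \<in> dyadic_reals \<longleftrightarrow> z \<in> dyadic_reals"
proof -
  have *: "z - 1 \<in> dyadic_reals \<longleftrightarrow> z \<in> dyadic_reals" for z
    using dyadic_reals_add[of "z - 1" 1] dyadic_reals_diff[of z 1] by auto
  show ?thesis
  proof (cases "z \<le> bend_break a")
    case True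
    have "bend a z \<in> dyadic_reals \<longleftrightarrow> bend a z - 1 \<in> dyadic_reals"
      by (simp only: *)
    also have "\<dots> \<longleftrightarrow> z \<in> dyadic_reals"
      using True by (simp add: bend_below *)
    finally show ?thesis .
  next
    case False
    then show ?thesis by (simp add: bend_above *)
  qed
qed

lemma bend_dyadic_PL_at: "dyadic_PL_at (bend a) z"
proof -
  consider "z < bend_break a" | "z = bend_break a" | "bend_break a < z" by fastforce
  then show ?thesis
    using bend_right_germ[where z = z and a = a] bend_left_germ[where z = z and a = a] bend_break_dyadic[of a]
    unfolding dyadic_PL_at_def by cases (auto simp: bend_dyadic_iff)
qed

lemma floor_log_2_scale:
  assumes "1 \<le> z" "z < (2::real)"
  shows "\<lfloor>log 2 (2 powi n * z)\<rfloor> = n"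
proof -
  have "(0::real) < 2 powi n * z" using assms by simp
  moreover have "log 2 (2 powi n * z) = n + log 2 z"
    using assms by (simp add: log_mult powr_real_of_int'[symmetric] )
  moreover have "0 \<le> log 2 z" "log 2 z < 1"
    using assms by (simp_all add: log_less_iff)
  ultimately show ?thesis by (simp add: floor_eq_iff)
qed

lemma binary_scale_obtain:
  assumes "x > (0::real)"
  obtains n z where "1 \<le> z" "z < 2" "x = 2 powi n * z"
proof -
  define n where "n = \<lfloor>log 2 x\<rfloor>"
  have "2 powr n \<le> x" "x < 2 powr (n + 1)"
    using assms floor_log_eq_powr_iff[of x 2 n] by (auto simp: n_def)
  then have "2 powi n \<le> x" "x < 2 powi n * 2"
    by (simp_all add: powr_real_of_int' powr_add)
  then have "1 \<le> x / 2 powi n" "x / 2 powi n < 2" "x = 2 powi n * (x / 2 powi n)"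
    by (simp_all add: field_simps)
  with that show thesis by blast
qed

text \<open>
  The extension of the bend from $[1,2]$ to all positive reals that is equivariant for the two
  scalings.  Its breaks accumulate at $0$ only.
\<close>

definition stretch :: "int \<Rightarrow> real \<Rightarrow> real" where
  "stretch a x = (if x \<le> 0 then 0 else
     2 powi (a * \<lfloor>log 2 x\<rfloor>) * bend a (2 powi (- \<lfloor>log 2 x\<rfloor>) * x))"

lemma stretch_0: "stretch a 0 = 0"
  by (simp add: stretch_def)

text \<open>
  The formula also holds at the right end $z = 2$, where the floor jumps: the pieces on adjacent
  periods fit together because the bend maps $2$ to $2^a$.
\<close>

lemma stretch_period:
  assumes "1 \<le> z" "z \<le> 2" "a \<ge> 1"
  shows "stretch a (2 powi n * z) = 2 powi (a * n) * bend a z"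
proof -
  have *: "stretch a (2 powi n * z) = 2 powi (a * n) * bend a z" if "1 \<le> z" "z < 2" for z n
  proof -
    have "\<not> 2 powi n * z \<le> 0" using that by (simp add: not_le)
    then show ?thesis
      using floor_log_2_scale[OF that, of n] by (simp add: stretch_def)
  qed
  show ?thesis
  proof (cases "z = 2")
    case True
    then have "2 powi n * z = 2 powi (n + 1) * 1" by (simp add: power_int_add)
    then show ?thesis
      using *[of 1 "n + 1"] True
      by (simp add: bend_1 bend_2[OF assms(3)] power_int_add[symmetric] algebra_simps)
  qed (use * assms in auto)
qed

lemma stretch_1: "a \<ge> 1 \<Longrightarrow> stretch a 1 = 1"
  using stretch_period[of 1 a 0] by (simp add: bend_1)

lemma stretch_scale:
  assumes "x \<ge> 0" "a \<ge> 1"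
  shows "stretch a (2 powi k * x) = 2 powi (a * k) * stretch a x"
proof (cases "x = 0")
  case False
  with assms(1) have "x > 0" by simp
  then obtain n z where z: "1 \<le> z" "z < 2" "x = 2 powi n * z"
    by (rule binary_scale_obtain)
  have eq: "2 powi k * x = 2 powi (k + n) * z"
    by (simp add: z(3) power_int_add)
  have "stretch a (2 powi k * x) = 2 powi (a * (k + n)) * bend a z"
    unfolding eq using z assms(2) by (intro stretch_period) auto
  also have "\<dots> = 2 powi (a * k) * stretch a x"
    using stretch_period[of z a n] z assms(2) by (simp add: power_int_add distrib_left)
  finally show ?thesis .
qed (simp add: stretch_0)

lemma stretch_mono:
  assumes "0 \<le> x" "x < y" "a \<ge> 1"
  shows "stretch a x < stretch a y"
proof -
  have bounds: "2 powi (a * n) \<le> stretch a (2 powi n * z)" "stretch a (2 powi n * z) < 2 powi (a * (n + 1))"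
    if "1 \<le> z" "z < 2" for n z
  proof -
    have "1 \<le> bend a z" "bend a z < 2 powi a"
      using that bend_mono[of 1 z a] bend_mono[of z 2 a] bend_1[of a] bend_2[OF assms(3)]
      by (cases "z = 1"; auto)+
    then show "2 powi (a * n) \<le> stretch a (2 powi n * z)" "stretch a (2 powi n * z) < 2 powi (a * (n + 1))"
      using stretch_period[of z a n] that assms(3) by (simp_all add: distrib_left power_int_add)
  qed
  from assms have "y > 0" by simp
  then obtain m w where w: "1 \<le> w" "w < 2" "y = 2 powi m * w"
    by (rule binary_scale_obtain)
  show ?thesis
  proof (cases "x = 0")
    case True
    have "0 < (2::real) powi (a * m)" by simp
    also have "\<dots> \<le> stretch a y" using bounds(1)[OF w(1,2)] w(3) by simp
    finally show ?thesis using True by (simp add: stretch_0)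
  next
    case False
    with assms have "x > 0" by simp
    then obtain n z where z: "1 \<le> z" "z < 2" "x = 2 powi n * z"
      by (rule binary_scale_obtain)
    consider "n < m" | "n = m" | "m + 1 \<le> n" by linarith
    then show ?thesis
    proof cases
      case 1
      then have "a * (n + 1) \<le> a * m" using assms(3) by simp
      then have "(2::real) powi (a * (n + 1)) \<le> 2 powi (a * m)"
        by (rule power_int_increasing) auto
      then show ?thesis
        using bounds(2)[OF z(1,2), of n] bounds(1)[OF w(1,2), of m] by (simp add: z(3) w(3))
    next
      case 2
      then have "z < w" using assms(2) z w by simp
      then show ?thesis
        using 2 stretch_period[of z a n] stretch_period[of w a n] z w assms(3) bend_mono
        by simp
    next
      case 3
      have "2 powi m * w < 2 powi m * 2" using w by simp
      also have "\<dots> = 2 powi (m + 1)" by (simp add: power_int_add)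
      also have "\<dots> \<le> 2 powi n" using 3 by (rule power_int_increasing) auto
      also have "\<dots> \<le> 2 powi n * z" using z by simp
      finally have False using assms(2) z w by simp
      then show ?thesis ..
    qed
  qed
qed

text \<open>
  Dividing the binary exponent of $y$ by $a$ with remainder moves $y$ into $[1,2^a)$.
\<close>

lemma stretch_surj:
  assumes "y > 0" "a \<ge> 1"
  obtains x where "x > 0" "stretch a x = y"
proof -
  from assms(1) obtain j w where w: "1 \<le> w" "w < 2" "y = 2 powi j * w"
    by (rule binary_scale_obtain)
  define n r where "n = j div a" and "r = j mod a"
  have r: "0 \<le> r" "r + 1 \<le> a" using assms(2) by (simp_all add: r_def add1_zle_eq)
  have "(1::real) * 1 \<le> 2 powi r * w"
    using w r by (intro mult_mono) auto
  moreover have "2 powi r * w < 2 powi a"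
  proof -
    have "2 powi r * w < 2 powi r * 2" using w by simp
    also have "\<dots> = 2 powi (r + 1)" by (simp add: power_int_add)
    also have "\<dots> \<le> 2 powi a" using r by (intro power_int_increasing) auto
    finally show ?thesis .
  qed
  ultimately obtain z where z: "1 \<le> z" "z < 2" "bend a z = 2 powi r * w"
    using bend_surj[of "2 powi r * w" a] assms(2) by auto
  have "j = a * n + r" by (simp add: n_def r_def)
  then have "stretch a (2 powi n * z) = y"
    using stretch_period[of z a n] z w(3) assms(2) by (simp add: power_int_add)
  moreover have "2 powi n * z > 0" using z by simp
  ultimately show thesis using that by blast
qed

text \<open>
  By equivariance it is enough to look at $[1,2)$.  There only the point $1$ needs care, since its left
  germ is a rescaled copy of the left germ of the bend at $2$.
\<close>

lemma stretch_dyadic_PL_at: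
  assumes "x > 0" "a \<ge> 1"
  shows "dyadic_PL_at (stretch a) x"
proof -
  have base: "dyadic_PL_at (stretch a) z" if z: "1 \<le> z" "z < 2" for z
  proof (cases "z = 1")
    case False
    then have "dyadic_PL_at (stretch a) z \<longleftrightarrow> dyadic_PL_at (bend a) z"
      using z stretch_period[of _ a 0] assms(2) by (intro dyadic_PL_at_cong[of 1 2]) auto
    then show ?thesis by (simp add: bend_dyadic_PL_at)
  next
    case True
    obtain k l where kl: "germ 1 (bend a) 1 k" "germ (-1) (bend a) 2 l"
      using bend_dyadic_PL_at unfolding dyadic_PL_at_def by blast
    have "germ 1 (stretch a) 1 k \<longleftrightarrow> germ 1 (bend a) 1 k"
    proof (rule germ_cong)
      show "\<forall>\<^sub>F t in at_right 0. stretch a (1 + 1 * t) = bend a (1 + 1 * t)"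
        using eventually_at_right_real[OF zero_less_one]
        by eventually_elim (use stretch_period[of _ a 0] assms(2) in auto)
    qed (simp add: stretch_1 assms bend_1)
    moreover have "germ (-1) (stretch a) 1 (- a + l + 1)"
    proof -
      \<comment> \<open>To the left of 1 the stretch is the bend on the period below.\<close>
      have "germ (-1) (\<lambda>x. 2 powi (- a) * bend a (2 powi 1 * x)) 1 (- a + l + 1)"
        using kl(2) by (intro germ_scale) simp
      moreover have "germ (-1) (stretch a) 1 m \<longleftrightarrow> germ (-1) (\<lambda>x. 2 powi (- a) * bend a (2 powi 1 * x)) 1 m" for m
      proof (rule germ_cong)
        have "(0::real) < 1 / 2" by simp
        from eventually_at_right_real[OF this]
        show "\<forall>\<^sub>F t in at_right 0. stretch a (1 + -1 * t) = 2 powi (- a) * bend a (2 powi 1 * (1 + -1 * t))"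
        proof eventually_elim
          case (elim t)
          then have "stretch a (2 powi (-1) * (2 powi 1 * (1 + -1 * t))) =
              2 powi (a * -1) * bend a (2 powi 1 * (1 + -1 * t))"
            using assms(2) by (intro stretch_period) auto
          then show ?case
            by (simp only: powi_cancel mult_minus1_right)
        qed
        show "stretch a 1 = 2 powi (- a) * bend a (2 powi 1 * 1)"
          using bend_2[OF assms(2)] by (simp add: stretch_1 assms power_int_minus)
      qed
      ultimately show ?thesis by simp
    qed
    ultimately show ?thesis
      using kl(1) True unfolding dyadic_PL_at_def by (auto simp: stretch_1 assms)
  qed
  from assms(1) obtain n z where z: "1 \<le> z" "z < 2" "x = 2 powi n * z"
    by (rule binary_scale_obtain)
  then have zx: "2 powi (- n) * x = z"
    by (simp add: mult.assoc[symmetric] power_int_add[symmetric])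
  have "dyadic_PL_at (\<lambda>x. 2 powi (a * n) * stretch a (2 powi (- n) * x)) x"
    by (rule dyadic_PL_at_scale) (use base z zx in simp)
  moreover have "2 powi (a * n) * stretch a (2 powi (- n) * y) = stretch a y" if "y > 0" for y
    using stretch_scale[of y a "- n"] that assms(2)
    by (simp add: mult.assoc[symmetric] power_int_add[symmetric])
  ultimately show ?thesis
    using dyadic_PL_at_cong[of 0 "x + 1" "stretch a" "\<lambda>x. 2 powi (a * n) * stretch a (2 powi (- n) * x)" x] assms(1)
    by auto
qed

definition unit_stretch :: "int \<Rightarrow> real \<Rightarrow> real" where
  "unit_stretch a = restrict (stretch a) {0..1}"

lemma stretch_local_PL:
  assumes "a \<ge> 1"
  shows "unit_stretch a \<in> local_PL"
proof -
  have mono: "strict_mono_on {0..1} (stretch a)"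
    by (rule strict_mono_onI) (auto intro: stretch_mono assms)
  have "stretch a ` {0..1} = {0..1}"
  proof (intro equalityI subsetI)
    fix y assume "y \<in> stretch a ` {0..1}"
    then obtain x where "x \<in> {0..1}" "y = stretch a x" by auto
    then show "y \<in> {0..1}"
      using strict_mono_on_leD[OF mono, of 0 x] strict_mono_on_leD[OF mono, of x 1]
      by (simp add: stretch_0 stretch_1 assms)
  next
    fix y :: real assume y: "y \<in> {0..1}"
    show "y \<in> stretch a ` {0..1}"
    proof (cases "y = 0")
      case True
      then show ?thesis using stretch_0[of a] by (metis atLeastAtMost_iff image_eqI order_refl zero_le_one)
    next
      case False
      with y have "y > 0" by simp
      then obtain x where x: "x > 0" "stretch a x = y"
        using stretch_surj assms by blast
      have "x \<le> 1"
        using stretch_mono[of 1 x a] x y assms by (cases "x \<le> 1") (auto simp: stretch_1)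
      with x show ?thesis by auto
    qed
  qed
  with mono have "bij_betw (stretch a) {0..1} {0..1}"
    by (simp add: bij_betw_def strict_mono_on_imp_inj_on)
  then have "bij_betw (unit_stretch a) {0..1} {0..1}"
    by (rule bij_betw_cong[THEN iffD1, rotated]) (simp add: unit_stretch_def)
  moreover have "dyadic_PL_at (unit_stretch a) x" if "0 < x" "x < 1" for x
    using that stretch_dyadic_PL_at[OF _ assms]
    by (subst dyadic_PL_at_cong[of 0 1 _ "stretch a"]) (auto simp: unit_stretch_def)
  moreover have "strict_mono_on {0..1} (unit_stretch a)"
    using mono by (simp add: unit_stretch_def strict_mono_on_def)
  ultimately show ?thesis
    by (simp add: local_PL_def Bij_def unit_stretch_def)
qed

lemma stretch_end_scaling:
  assumes "a \<ge> 1"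
  shows "end_scaling 1 0 a (unit_stretch a)"
  unfolding end_scaling_def
proof
  fix k
  have ends: "\<forall>\<^sub>F t in at_right 0. t \<in> {0<..<1::real}"
    by (rule eventually_at_right_real) simp
  have "\<forall>\<^sub>F t in at_right 0. 2 powi k * t \<in> {0<..<1::real}"
    using ends by (rule eventually_at_right_0_scale[rotated]) simp
  with ends show "\<forall>\<^sub>F t in at_right 0. unit_stretch a (0 + 1 * (2 powi k * t)) - 0 =
      2 powi (a * k) * (unit_stretch a (0 + 1 * t) - 0)"
    by eventually_elim (simp add: unit_stretch_def stretch_scale assms)
qed

lemma stretch_germ_1:
  assumes "a \<ge> 1"
  obtains l where "germ (-1) (unit_stretch a) 1 l"
proof -
  obtain l where "germ (-1) (stretch a) 1 l"
    using stretch_dyadic_PL_at[OF zero_less_one assms] unfolding dyadic_PL_at_def by blast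
  moreover have "germ (-1) (unit_stretch a) 1 l \<longleftrightarrow> germ (-1) (stretch a) 1 l"
    by (rule germ_cong[OF eventually_mono[OF eventually_at_right_real[OF zero_less_one]]])
      (simp_all add: unit_stretch_def)
  ultimately show thesis using that by blast
qed

text \<open>
  The stretch rescales slopes at $0$ and is linear near $1$; the reflected stretch does the opposite.
  Their product therefore rescales slopes by $a$ at $0$ and by $b$ at $1$.
\<close>

lemma two_sided_stretch:
  assumes "a \<ge> 1" "b \<ge> 1"
  obtains \<theta> where "\<theta> \<in> local_PL" "end_scaling 1 0 a \<theta>" "end_scaling (-1) 1 b \<theta>"
proof -
  have e: "(0, 1) \<in> interval_ends" "(1, -1) \<in> interval_ends"
    by (simp_all add: interval_ends_def)
  let ?A = "unit_stretch a" and ?B = "reflect (unit_stretch b)"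
  have A: "?A \<in> local_PL" and B: "?B \<in> local_PL"
    using assms by (auto intro: reflect_local_PL stretch_local_PL)
  obtain k where "germ (-1) ?A 1 k" using stretch_germ_1[OF assms(1)] .
  then have A1: "end_scaling (-1) 1 1 ?A"
    using local_PL_ends[OF A e(2)] by (rule germ_imp_end_scaling)
  obtain l where "germ (-1) (unit_stretch b) 1 l" using stretch_germ_1[OF assms(2)] .
  then have "germ 1 ?B 0 l"
    using germ_end_reflect[OF e(2)] by fastforce
  then have B0: "end_scaling 1 0 1 ?B"
    using local_PL_ends[OF B e(1)] by (rule germ_imp_end_scaling)
  have B1: "end_scaling (-1) 1 b ?B"
    using end_scaling_reflect[OF e(1) stretch_end_scaling[OF assms(2)]] by simp
  show thesis
  proof (rule that)
    show "?A \<otimes>\<^bsub>BG\<^esub> ?B \<in> local_PL" using A B by (rule mult_local_PL)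
    show "end_scaling 1 0 a (?A \<otimes>\<^bsub>BG\<^esub> ?B)"
      using end_scaling_mult[OF A B e(1) stretch_end_scaling[OF assms(1)] B0] by simp
    show "end_scaling (-1) 1 b (?A \<otimes>\<^bsub>BG\<^esub> ?B)"
      using end_scaling_mult[OF A B e(2) A1 B1] by simp
  qed
qed

section \<open>The slope homomorphism and the extension\<close>

definition log_slope :: "real \<Rightarrow> real \<Rightarrow> (real \<Rightarrow> real) \<Rightarrow> int" where
  "log_slope s p f = (THE k. germ s f p k)"

lemma log_slope_eq: "(p, s) \<in> interval_ends \<Longrightarrow> germ s f p k \<Longrightarrow> log_slope s p f = k"
  unfolding log_slope_def by (rule the_equality) (auto dest: germ_unique simp: interval_ends_def)

lemma thompson_F_local_PL: "f \<in> carrier thompson_F \<Longrightarrow> f \<in> local_PL"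
  by (simp add: carrier_thompson_F)

lemma thompson_F_germ:
  assumes "f \<in> carrier thompson_F" "(p, s) \<in> interval_ends"
  shows "germ s f p (log_slope s p f)"
proof -
  obtain k where "germ s f p k"
    using assms unfolding carrier_thompson_F by auto
  with log_slope_eq[OF assms(2)] show ?thesis by simp
qed

lemma thompson_FI:
  assumes "f \<in> local_PL" "\<And>p s. (p, s) \<in> interval_ends \<Longrightarrow> germ s f p (k s p)"
  shows "f \<in> carrier thompson_F"
proof -
  have "\<exists>k. germ s f p k" if "(p, s) \<in> interval_ends" for p s
    using assms(2)[OF that] by (rule exI)
  with assms(1) show ?thesis
    unfolding carrier_thompson_F by auto
qed

lemma thompson_F_eq: "thompson_F = BG\<lparr>carrier := carrier thompson_F\<rparr>"
  by (simp add: thompson_F_def)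

lemma mult_thompson_F [simp]: "x \<otimes>\<^bsub>thompson_F\<^esub> y = x \<otimes>\<^bsub>BG\<^esub> y"
  and one_thompson_F [simp]: "\<one>\<^bsub>thompson_F\<^esub> = \<one>\<^bsub>BG\<^esub>"
  by (simp_all add: thompson_F_def)

lemma subgroup_thompson_F: "subgroup (carrier thompson_F) BG"
proof (rule BG.subgroupI)
  show "carrier thompson_F \<subseteq> carrier BG"
    using local_PL_Bij thompson_F_local_PL by (auto simp: carrier_BG)
  have "\<one>\<^bsub>BG\<^esub> \<in> carrier thompson_F"
    by (rule thompson_FI[OF one_local_PL germ_end_one])
  then show "carrier thompson_F \<noteq> {}" by blast
  fix f assume f: "f \<in> carrier thompson_F"
  note fL = thompson_F_local_PL[OF f] and fg = thompson_F_germ[OF f]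
  show "inv\<^bsub>BG\<^esub> f \<in> carrier thompson_F"
    by (rule thompson_FI[OF inv_local_PL[OF fL] germ_end_inv[OF fL _ fg]])
  fix g assume g: "g \<in> carrier thompson_F"
  note gL = thompson_F_local_PL[OF g] and gg = thompson_F_germ[OF g]
  show "f \<otimes>\<^bsub>BG\<^esub> g \<in> carrier thompson_F"
    by (rule thompson_FI[OF mult_local_PL[OF fL gL] germ_end_mult[OF fL gL _ fg gg]])
qed

lemma group_thompson_F: "group thompson_F"
  by (subst thompson_F_eq) (rule subgroup.subgroup_is_group[OF subgroup_thompson_F group_BijGroup])

interpretation F: group thompson_F
  by (rule group_thompson_F)

lemma log_slope_mult:
  assumes "f \<in> carrier thompson_F" "g \<in> carrier thompson_F" "(p, s) \<in> interval_ends"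
  shows "log_slope s p (f \<otimes>\<^bsub>BG\<^esub> g) = log_slope s p f + log_slope s p g"
  using assms by (intro log_slope_eq germ_end_mult thompson_F_local_PL thompson_F_germ)

lemma log_slope_pow:
  assumes "f \<in> carrier thompson_F" "(p, s) \<in> interval_ends"
  shows "log_slope s p (f [^]\<^bsub>thompson_F\<^esub> (n::nat)) = int n * log_slope s p f"
proof (induction n)
  case 0
  then show ?case using log_slope_eq[OF assms(2) germ_end_one[OF assms(2)]] by simp
next
  case (Suc n)
  then show ?case
    using log_slope_mult[OF F.nat_pow_closed[OF assms(1)] assms] by (simp add: algebra_simps)
qed

text \<open>
  An element of $F$ that is the identity near $0$ and has slope $2$ at $1$: its slopes $1, 1/2, 2$ on
  intervals of lengths $1/4, 1/2, 1/4$ have weighted mean $1$.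
\<close>

definition end_bump :: "real \<Rightarrow> real" where
  "end_bump = (\<lambda>x\<in>{0..1}. max (min x (x / 2 + 1 / 8)) (2 * x - 1))"

lemma end_bump_pieces:
  "0 \<le> x \<Longrightarrow> x \<le> 1 / 4 \<Longrightarrow> end_bump x = x"
  "1 / 4 \<le> x \<Longrightarrow> x \<le> 3 / 4 \<Longrightarrow> end_bump x = x / 2 + 1 / 8"
  "3 / 4 \<le> x \<Longrightarrow> x \<le> 1 \<Longrightarrow> end_bump x = 2 * x - 1"
  by (auto simp: end_bump_def max_def min_def)

lemma end_bump_thompson_F: "end_bump \<in> carrier thompson_F"
proof -
  have mono: "strict_mono_on {0..1} end_bump"
    by (rule strict_mono_onI) (auto simp: end_bump_def max_def min_def)
  have "end_bump ` {0..1} = {0..1}"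
  proof (intro equalityI subsetI)
    fix y assume "y \<in> end_bump ` {0..1}"
    then obtain x where x: "0 \<le> x" "x \<le> 1" "y = end_bump x" by auto
    consider "x \<le> 1 / 4" | "1 / 4 \<le> x" "x \<le> 3 / 4" | "3 / 4 \<le> x" by linarith
    then show "y \<in> {0..1}"
      by cases (use x in \<open>simp_all add: end_bump_pieces\<close>)
  next
    fix y :: real assume y: "y \<in> {0..1}"
    consider "y \<le> 1 / 4" | "1 / 4 \<le> y" "y \<le> 1 / 2" | "1 / 2 \<le> y" by linarith
    then show "y \<in> end_bump ` {0..1}"
    proof cases
      case 1
      then show ?thesis using y by (intro image_eqI[of _ _ y]) (auto simp: end_bump_pieces)
    next
      case 2
      then show ?thesis using y by (intro image_eqI[of _ _ "2 * y - 1 / 4"]) (simp_all add: end_bump_pieces field_simps)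
    next
      case 3
      then show ?thesis using y by (intro image_eqI[of _ _ "(y + 1) / 2"]) (simp_all add: end_bump_pieces field_simps)
    qed
  qed
  then have bij: "end_bump \<in> Bij {0..1}"
    using strict_mono_on_imp_inj_on[OF mono] by (simp add: Bij_def bij_betw_def) (simp add: end_bump_def)
  then have "\<exists>g. homeomorphism {0..1} {0..1} end_bump g"
    using continuous_increasing_bij[OF bij mono]
    by (intro homeomorphism_compact) (auto simp: Bij_def bij_betw_def)
  moreover have "dyadic_piecewise_linear end_bump"
    unfolding dyadic_piecewise_linear_def
  proof (intro exI[of _ "{1 / 4, 3 / 4}"] conjI allI impI)
    show "{1 / 4, 3 / 4 :: real} \<subseteq> dyadics"
    proof -
      have "1 / 4 \<in> dyadic_reals" "3 / 4 \<in> dyadic_reals"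
        unfolding dyadic_reals_def by (auto intro!: exI[of _ 2])
      then show ?thesis
        by (simp add: dyadic_reals_iff_dyadics)
    qed
    fix u v :: real
    assume uv: "0 \<le> u \<and> u < v \<and> v \<le> 1 \<and> {u<..<v} \<inter> {1 / 4, 3 / 4} = {}"
    then consider "v \<le> 1 / 4" | "1 / 4 \<le> u" "v \<le> 3 / 4" | "3 / 4 \<le> u"
      by fastforce
    then show "\<exists>(k::int) c. \<forall>x\<in>{u..v}. end_bump x = 2 powi k * x + c"
    proof cases
      case 1
      then show ?thesis using uv by (intro exI[of _ 0] exI[of _ 0]) (auto simp: end_bump_pieces)
    next
      case 2
      then show ?thesis using uv
        by (intro exI[of _ "-1"] exI[of _ "1 / 8"]) (auto simp: end_bump_pieces power_int_minus)
    next
      case 3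
      then show ?thesis using uv by (intro exI[of _ 1] exI[of _ "-1"]) (auto simp: end_bump_pieces)
    qed
  qed simp
  ultimately show ?thesis
    using bij mono by (simp add: thompson_F_def)
qed

lemma end_bump_germs: "germ 1 end_bump 0 0" "germ (-1) end_bump 1 1"
  using affine_germ(1)[of 0 "1 / 4" end_bump 0 0 0] affine_germ(2)[of "3 / 4" 1 end_bump 1 "-1" 1]
  by (auto simp: end_bump_pieces)

lemma interval_ends_simps [simp]: "(0, 1) \<in> interval_ends" "(1, - 1) \<in> interval_ends"
  by (simp_all add: interval_ends_def)

text \<open>
  The bump and its reflection have slope exponents $(0,1)$ and $(1,0)$, so products of their powers
  realise every pair of natural numbers, and these represent all pairs of residues.
\<close>

lemma log_slopes_surj:
  "\<exists>f \<in> carrier thompson_F. log_slope 1 0 f = int i \<and> log_slope (-1) 1 f = int j"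
proof -
  let ?w = "end_bump" and ?v = "reflect end_bump"
  have w: "?w \<in> carrier thompson_F" by (rule end_bump_thompson_F)
  have vg: "germ 1 ?v 0 1" "germ (-1) ?v 1 0"
    using germ_end_reflect[OF _ end_bump_germs(2)] germ_end_reflect[OF _ end_bump_germs(1)] by simp_all
  have v: "?v \<in> carrier thompson_F"
    unfolding carrier_thompson_F using vg reflect_local_PL[OF thompson_F_local_PL[OF w]]
    by (auto simp: interval_ends_def)
  have s: "log_slope 1 0 ?w = 0" "log_slope (-1) 1 ?w = 1" "log_slope 1 0 ?v = 1" "log_slope (-1) 1 ?v = 0"
    using end_bump_germs vg by (simp_all add: log_slope_eq)
  let ?f = "?w [^]\<^bsub>thompson_F\<^esub> j \<otimes>\<^bsub>thompson_F\<^esub> ?v [^]\<^bsub>thompson_F\<^esub> i"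
  have "?f \<in> carrier thompson_F"
    using w v by (intro F.m_closed F.nat_pow_closed)
  moreover have "log_slope 1 0 ?f = int i" "log_slope (-1) 1 ?f = int j"
    using w v by (simp_all add: log_slope_mult log_slope_pow s)
  ultimately show ?thesis by blast
qed

text \<open>
  An increasing map that moves a point up moves it up further with every iteration, and likewise
  downwards.
\<close>

lemma thompson_F_torsion_free:
  assumes f: "f \<in> carrier thompson_F" and "f [^]\<^bsub>thompson_F\<^esub> (n::nat) = \<one>\<^bsub>thompson_F\<^esub>" "n > 0"
  shows "f = \<one>\<^bsub>thompson_F\<^esub>"
proof -
  let ?p = "\<lambda>n::nat. f [^]\<^bsub>thompson_F\<^esub> n"
  have L: "?p n \<in> local_PL" "?p n \<in> Bij {0..1}" for n
    using f by (auto intro: thompson_F_local_PL local_PL_Bij)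
  have fB: "f \<in> Bij {0..1}" using f thompson_F_local_PL local_PL_Bij by blast
  have pSuc: "?p (Suc n) x = ?p n (f x)" if "x \<in> {0..1}" for n x
    using mult_BG_apply[OF L(2) fB that] by simp
  have mono: "?p n x < ?p n y" if "x \<in> {0..1}" "y \<in> {0..1}" "x < y" for n x y
    using strict_mono_onD[OF local_PL_mono[OF L(1)] that] .
  have up: "?p (Suc n) x > x" if x: "x \<in> {0..1}" "f x > x" for n x
  proof (induction n)
    case 0
    show ?case
      unfolding pSuc[OF x(1)] using x(2) Bij_mem[OF fB x(1)] by (simp add: one_BG_apply)
  next
    case (Suc n)
    then show ?case
      using mono[OF x(1) Bij_mem[OF fB x(1)] x(2), of "Suc n"] pSuc[OF x(1)]
      by (metis less_trans)
  qed
  have down: "?p (Suc n) x < x" if x: "x \<in> {0..1}" "f x < x" for n x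
  proof (induction n)
    case 0
    show ?case
      unfolding pSuc[OF x(1)] using x(2) Bij_mem[OF fB x(1)] by (simp add: one_BG_apply)
  next
    case (Suc n)
    then show ?case
      using mono[OF Bij_mem[OF fB x(1)] x(1) x(2), of "Suc n"] pSuc[OF x(1)]
      by (metis less_trans)
  qed
  obtain m where m: "n = Suc m" using assms(3) gr0_implies_Suc by blast
  have "f x = x" if x: "x \<in> {0..1}" for x
  proof -
    have "?p (Suc m) x = x"
      using assms(2) one_BG_apply[OF x] by (simp only: m one_thompson_F)
    with up[OF x, of m] down[OF x, of m] show ?thesis by linarith
  qed
  then have "f = \<one>\<^bsub>BG\<^esub>"
    using Bij_imp_extensional[OF fB] one_BG_apply
    by (intro extensionalityI[of _ "{0..1}"]) (auto simp: BijGroup_def)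
  then show ?thesis by simp
qed


definition end_slopes :: "nat \<Rightarrow> nat \<Rightarrow> (real \<Rightarrow> real) \<Rightarrow> int \<times> int" where
  "end_slopes a b f = (log_slope 1 0 f mod int a, log_slope (-1) 1 f mod int b)"

abbreviation (input) "ZZ a b \<equiv> integer_mod_group a \<times>\<times> integer_mod_group b"

lemma group_ZZ: "group (ZZ a b)"
  by (intro DirProd_group) simp_all

lemma end_slopes_epi:
  assumes "a > 0" "b > 0"
  shows "end_slopes a b \<in> epi thompson_F (ZZ a b)"
proof -
  have hom: "end_slopes a b \<in> hom thompson_F (ZZ a b)"
    using assms by (auto intro!: homI simp: end_slopes_def carrier_integer_mod_group log_slope_mult mod_add_eq)
  have "q \<in> end_slopes a b ` carrier thompson_F" if "q \<in> carrier (ZZ a b)" for q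
  proof -
    from that assms obtain i j where q: "q = (int i, int j)" "i < a" "j < b"
      by (auto simp: carrier_integer_mod_group) (metis of_nat_less_iff zero_le_imp_eq_int)
    obtain f where "f \<in> carrier thompson_F" "log_slope 1 0 f = int i" "log_slope (-1) 1 f = int j"
      using log_slopes_surj by blast
    with q show ?thesis
      by (intro image_eqI[of _ _ f]) (auto simp: end_slopes_def)
  qed
  with hom_carrier[OF hom] have "end_slopes a b ` carrier thompson_F = carrier (ZZ a b)"
    by (intro equalityI subsetI) (rule subsetD)
  with hom show ?thesis
    by (simp add: epi_def)
qed

lemma ZZ_pow: "(x, y) [^]\<^bsub>ZZ a b\<^esub> (n::nat) = ((int n * x) mod int a, (int n * y) mod int b)"
proof -
  have "(x, y) [^]\<^bsub>ZZ a b\<^esub> n = (x [^]\<^bsub>integer_mod_group a\<^esub> n, y [^]\<^bsub>integer_mod_group b\<^esub> n)"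
    by (induction n) (simp_all del: pow_integer_mod_group add: nat_pow_def)
  then show ?thesis by simp
qed

text \<open>
  A section would embed the finite quotient into $F$, which has no elements of finite order except
  the identity.
\<close>

lemma end_slopes_not_split:
  assumes "a > 0" "b > 0" "\<not> (a = 1 \<and> b = 1)"
  shows "\<not> split_extension thompson_F (ZZ a b) (end_slopes a b)"
proof
  assume "split_extension thompson_F (ZZ a b) (end_slopes a b)"
  then obtain \<sigma> where \<sigma>: "\<sigma> \<in> hom (ZZ a b) thompson_F" "\<And>q. q \<in> carrier (ZZ a b) \<Longrightarrow> end_slopes a b (\<sigma> q) = q"
    unfolding split_extension_def by blast
  interpret Q: group "ZZ a b" by (rule group_ZZ)
  interpret \<sigma>: group_hom "ZZ a b" thompson_F \<sigma>
    by unfold_locales (rule \<sigma>(1))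
  obtain q where q: "q \<in> carrier (ZZ a b)" "q \<noteq> \<one>\<^bsub>ZZ a b\<^esub>"
  proof (cases "a = 1")
    case False
    then show thesis by (intro that[of "(1, 0)"]) auto
  next
    case True
    with assms(3) show thesis by (intro that[of "(0, 1)"]) auto
  qed
  have "q [^]\<^bsub>ZZ a b\<^esub> (a * b) = \<one>\<^bsub>ZZ a b\<^esub>"
    by (cases q) (simp add: ZZ_pow)
  then have "\<sigma> q [^]\<^bsub>thompson_F\<^esub> (a * b) = \<one>\<^bsub>thompson_F\<^esub>"
    by (simp only: \<sigma>.hom_nat_pow[OF q(1), symmetric] \<sigma>.hom_one)
  then have "\<sigma> q = \<one>\<^bsub>thompson_F\<^esub>"
    using thompson_F_torsion_free[OF \<sigma>.hom_closed[OF q(1)]] assms by simp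
  also have "\<dots> = \<sigma> \<one>\<^bsub>ZZ a b\<^esub>"
    by (rule \<sigma>.hom_one[symmetric])
  finally have "end_slopes a b (\<sigma> q) = end_slopes a b (\<sigma> \<one>\<^bsub>ZZ a b\<^esub>)"
    by (rule arg_cong)
  then have "q = \<one>\<^bsub>ZZ a b\<^esub>"
    unfolding \<sigma>(2)[OF q(1)] \<sigma>(2)[OF Q.one_closed] .
  with q(2) show False ..
qed

text \<open>
  Conjugation by $\theta$ multiplies the slope exponents by $a$ and $b$, so it maps $F$ into the kernel;
  conversely the inverse conjugation divides the exponents of an element of the kernel, which are
  multiples of $a$ and $b$, and yields a map that is affine near the ends, hence in $F$.
\<close>

lemma conj_extension:
  assumes ab: "a > 0" "b > 0"
    and \<theta>: "\<theta> \<in> local_PL" "end_scaling 1 0 (int a) \<theta>" "end_scaling (-1) 1 (int b) \<theta>"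
  shows "group_extension thompson_F thompson_F (ZZ a b)
    (\<lambda>g. \<theta> \<otimes>\<^bsub>BG\<^esub> g \<otimes>\<^bsub>BG\<^esub> inv\<^bsub>BG\<^esub> \<theta>) (end_slopes a b)"
proof -
  let ?\<eta> = "inv\<^bsub>BG\<^esub> \<theta>"
  let ?c = "\<lambda>g. \<theta> \<otimes>\<^bsub>BG\<^esub> g \<otimes>\<^bsub>BG\<^esub> ?\<eta>"
  have \<eta>: "?\<eta> \<in> local_PL" by (rule inv_local_PL[OF \<theta>(1)])
  have L: "f \<in> carrier BG" if "f \<in> local_PL" for f
    using that by (simp add: carrier_BG local_PL_Bij)
  note FL = thompson_F_local_PL
  have cL: "?c g \<in> local_PL" if "g \<in> local_PL" for g
    using that \<theta>(1) \<eta> by (blast intro: mult_local_PL)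
  have germs: "germ 1 (?c g) 0 (int a * log_slope 1 0 g)" "germ (-1) (?c g) 1 (int b * log_slope (-1) 1 g)"
    if "g \<in> carrier thompson_F" for g
    using that \<theta> by (auto intro!: germ_conj FL thompson_F_germ)
  have cF: "?c g \<in> carrier thompson_F" if "g \<in> carrier thompson_F" for g
    unfolding carrier_thompson_F using germs[OF that] cL[OF FL[OF that]]
    by (auto simp: interval_ends_def)
  have slopes: "end_slopes a b (?c g) = (0, 0)" if "g \<in> carrier thompson_F" for g
    using germs[OF that] by (simp add: end_slopes_def log_slope_eq)
  have canc: "?\<eta> \<otimes>\<^bsub>BG\<^esub> (\<theta> \<otimes>\<^bsub>BG\<^esub> f) = f" "\<theta> \<otimes>\<^bsub>BG\<^esub> (?\<eta> \<otimes>\<^bsub>BG\<^esub> f) = f" if "f \<in> carrier BG" for f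
    using that L[OF \<theta>(1)] by (simp_all add: BG.m_assoc[symmetric])
  have hom: "?c \<in> hom thompson_F thompson_F"
  proof (rule homI)
    fix f g assume "f \<in> carrier thompson_F" "g \<in> carrier thompson_F"
    then have "f \<in> carrier BG" "g \<in> carrier BG" using FL L by blast+
    then show "?c (f \<otimes>\<^bsub>thompson_F\<^esub> g) = ?c f \<otimes>\<^bsub>thompson_F\<^esub> ?c g"
      using L[OF \<theta>(1)] by (simp add: BG.m_assoc canc)
  qed (rule cF)
  have inj: "inj_on ?c (carrier thompson_F)"
  proof (rule inj_onI)
    fix f g assume fg: "f \<in> carrier thompson_F" "g \<in> carrier thompson_F" "?c f = ?c g"
    then have "f \<in> carrier BG" "g \<in> carrier BG" using FL L by blast+
    with fg(3) show "f = g" using L[OF \<theta>(1)] by simp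
  qed
  have "f \<in> ?c ` carrier thompson_F" if f: "f \<in> carrier thompson_F" "end_slopes a b f = (0, 0)" for f
  proof
    let ?g = "?\<eta> \<otimes>\<^bsub>BG\<^esub> f \<otimes>\<^bsub>BG\<^esub> \<theta>"
    have fB: "f \<in> carrier BG" using f FL L by blast
    then show "f = ?c ?g"
      using L[OF \<theta>(1)] by (simp add: BG.m_assoc canc)
    obtain k l where "log_slope 1 0 f = int a * k" "log_slope (-1) 1 f = int b * l"
      using f(2) by (auto simp: end_slopes_def mod_eq_0_iff_dvd elim!: dvdE)
    then have "germ 1 f 0 (int a * k)" "germ (-1) f 1 (int b * l)"
      using thompson_F_germ[OF f(1), of 0 1] thompson_F_germ[OF f(1), of 1 "-1"] by simp_all
    then have "germ 1 ?g 0 k" "germ (-1) ?g 1 l"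
      using \<theta> f(1) by (auto intro!: germ_conj_inverse FL)
    moreover have "?g \<in> local_PL"
      using \<theta>(1) \<eta> FL[OF f(1)] by (blast intro: mult_local_PL)
    ultimately show "?g \<in> carrier thompson_F"
      unfolding carrier_thompson_F by (auto simp: interval_ends_def)
  qed
  then have "?c ` carrier thompson_F = kernel thompson_F (ZZ a b) (end_slopes a b)"
    using cF slopes by (auto simp: kernel_def)
  moreover have "end_slopes a b \<in> hom thompson_F (ZZ a b)"
    using end_slopes_epi[OF ab] by (simp add: epi_def)
  ultimately show ?thesis
    using hom inj end_slopes_epi[OF ab] group_thompson_F group_ZZ
    by (simp add: group_extension_def mon_def group_hom_def group_hom_axioms_def)
qed

theorem theorem1p2:
  fixes a b :: nat
  assumes "a > 0" and "b > 0"
  shows "\<exists>(\<iota> :: (real \<Rightarrow> real) \<Rightarrow> (real \<Rightarrow> real)) (\<tau> :: (real \<Rightarrow> real) \<Rightarrow> int \<times> int).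
    group_extension thompson_F thompson_F (integer_mod_group a \<times>\<times> integer_mod_group b) \<iota> \<tau> \<and>
    (\<not> (a = 1 \<and> b = 1) \<longrightarrow>
      \<not> split_extension thompson_F (integer_mod_group a \<times>\<times> integer_mod_group b) \<tau>)"
proof -
  obtain \<theta> where \<theta>: "\<theta> \<in> local_PL" "end_scaling 1 0 (int a) \<theta>"
    "end_scaling (-1) 1 (int b) \<theta>"
    using two_sided_stretch[of "int a" "int b"] assms by auto
  show ?thesis
    by (intro exI conjI impI) (rule conj_extension[OF assms \<theta>], rule end_slopes_not_split[OF assms])
qed

end
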